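(* Suppose that the toric ideals $I_A, I_{B_1},\ldots,I_{B_d}$ possess quadratic Gröbner bases $\mathcal{G}_0,\mathcal{G}_1,\ldots,\mathcal{G}_d$ with respect to monomial orders $<_0,<_1,\ldots,<_d$, respectively. Then the toric ideal $I_{A(B_1,\ldots,B_d)}$ possesses a quadratic Gröbner basis. More precisely, there is a monomial order on $K[\mathbf{x}]$ with respect to which the reduced Gröbner basis of $I_{A(B_1,\ldots,B_d)}$ is the set $\mathcal{G}$ of all (nonzero) binomials of the form $$x_{M_\alpha}x_{M_\beta}-x_{M_\gamma}x_{M_\delta}\qquad(\alpha,\beta,\gamma,\delta\in\{1,\ldots,\eta\}),$$ where the standard expressions of $M_\gamma$ and $M_\delta$ are $$M_\gamma=m_{j_1}^{(i_1)}m_{j_2}^{(i_2)}\cdots m_{j_r}^{(i_r)},\qquad M_\delta=m_{\ell_1}^{(k_1)}m_{\ell_2}^{(k_2)}\cdots m_{\ell_s}^{(k_s)},$$ with $\gamma\le\delta$, and (1) $\varphi_j(x_{M_\alpha}x_{M_\beta})\xrightarrow{\ \mathcal{G}_j\ }\varphi_j(x_{M_\gamma}x_{M_\delta})$ for each $j=0,1,\ldots,d$; (2) for all $1\le\lambda\le r$ and $1\le\mu\le s$: if $i_\lambda=k_\mu$ then $j_\lambda\le\ell_\mu$. The initial monomial of $x_{M_\alpha}x_{M_\beta}-x_{M_\gamma}x_{M_\delta}$ is $x_{M_\alpha}x_{M_\beta}$.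
   Context: Let $K$ be a field. A finite set $A$ of monomials of a polynomial ring $K[t_1,\ldots,t_d]$ is called a configuration if there is a nonnegative vector $(w_1,\ldots,w_d)\in\mathbb{R}_{\ge 0}^d$ with $\sum_{i=1}^d w_i a_i = 1$ for all $t_1^{a_1}\cdots t_d^{a_d}\in A$. The toric ideal $I_A$ of a configuration $A$ is the kernel of the $K$-algebra homomorphism from the polynomial ring over $K$ with one variable $x_M$ (of degree 1) for each $M\in A$ to $K[t_1,\ldots,t_d]$ sending $x_M\mapsto M$. A Gröbner basis is called quadratic if it consists of quadratic homogeneous polynomials (all variables having degree 1). Let $A$ be a configuration of $K[\mathbf{t}]=K[t_1,\ldots,t_d]$. For each $i=1,\ldots,d$ let $B_i=\{m_1^{(i)},\ldots,m_{\lambda_i}^{(i)}\}$ be a configuration of a polynomial ring $K[\mathbf{u}^{(i)}]=K[u_1^{(i)},\ldots,u_{\mu_i}^{(i)}]$ in $\mu_i$ variables (the variables for different $i$ are distinct). The nested configuration arising from $A$ and $B_1,\ldots,B_d$ is the configuration $$A(B_1,\ldots,B_d)=\left\{ m_{j_1}^{(i_1)}\cdots m_{j_r}^{(i_r)} \;\middle|\; 1\le r\in\mathbb{Z},\ t_{i_1}\cdots t_{i_r}\in A,\ 1\le j_k\le \lambda_{i_k}\right\}$$ of $K[\mathbf{u}^{(1)},\ldots,\mathbf{u}^{(d)}]$. Write $A(B_1,\ldots,B_d)=\{M_1,\ldots,M_\eta\}$ with $\eta$ its cardinality; the enumeration is subject to the convention stated at the end. Polynomial rings: $K[\mathbf{x}]=K[x_{M_1},\ldots,x_{M_\eta}]$;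 $K[\mathbf{y}]$ has one variable $y_{i_1\cdots i_r}$ for each $r\ge1$ and $i_1\le\cdots\le i_r$ with $t_{i_1}\cdots t_{i_r}\in A$; $K[\mathbf{z}^{(i)}]=K[z_1^{(i)},\ldots,z_{\lambda_i}^{(i)}]$ for $i=1,\ldots,d$. Thus $I_A$ is the kernel of $\pi_0:K[\mathbf{y}]\to K[\mathbf{t}]$, $y_{i_1\cdots i_r}\mapsto t_{i_1}\cdots t_{i_r}$; $I_{B_i}$ is the kernel of $\pi_i:K[\mathbf{z}^{(i)}]\to K[\mathbf{u}^{(i)}]$, $z_j^{(i)}\mapsto m_j^{(i)}$; and $I_{A(B_1,\ldots,B_d)}$ is the kernel of $\pi:K[\mathbf{x}]\to K[\mathbf{u}^{(1)},\ldots,\mathbf{u}^{(d)}]$, $x_M\mapsto M$. For $M\in A(B_1,\ldots,B_d)$, an expression $M=m_{j_1}^{(i_1)}\cdots m_{j_r}^{(i_r)}$ (with $t_{i_1}\cdots t_{i_r}\in A$) is called standard if for every $1\le j\le d$ the monomial $\prod_{1\le k\le r,\ i_k=j} z_{j_k}^{(i_k)}$ is standard with respect to $\mathcal{G}_j$, i.e. is divisible by no initial monomial (w.r.t. $<_j$) of an element of the Gröbner basis $\mathcal{G}_j$ of $I_{B_j}$. The standard expression of $M$ is unique up to order of factors. The $K$-algebra homomorphisms $\varphi_0:K[\mathbf{x}]\to K[\mathbf{y}]$ and $\varphi_j:K[\mathbf{x}]\to K[\mathbf{z}^{(j)}]$ ($1\le j\le d$) are defined, when $M=m_{j_1}^{(i_1)}\cdots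 m_{j_r}^{(i_r)}$ is the standard expression of $M$ with factors ordered so that $i_1\le\cdots\le i_r$, by $$\varphi_0(x_M)=y_{i_1\cdots i_r},\qquad \varphi_j(x_M)=\prod_{1\le k\le r,\ i_k=j} z_{j_k}^{(i_k)}.$$ Convention on the enumeration: the monomials of $A(B_1,\ldots,B_d)$ are ordered as $M_1,\ldots,M_\eta$ in such a way that $$\pi_0\circ\varphi_0(x_{M_1})\ge_{lex}\cdots\ge_{lex}\pi_0\circ\varphi_0(x_{M_\eta}),$$ where $\ge_{lex}$ denotes the lexicographic order on monomials of $K[\mathbf{t}]$ induced by $t_1>\cdots>t_d$. The condition $\gamma\le\delta$ in the claim refers to the indices in this enumeration. For monomials $u,v$, the notation $u\xrightarrow{\ \mathcal{G}_j\ }v$ means that $v$ is the normal form (remainder) of $u$ modulo the Gröbner basis $\mathcal{G}_j$; in particular $u\xrightarrow{\ \mathcal{G}_j\ }u$ when $u$ is standard with respect to $\mathcal{G}_j$.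
   Formalization: Ties in the enumeration: when two monomials have equal image under π_0∘φ_0 and satisfy condition (2) as an ordered pair, the first is required to come first; with arbitrary tie-breaking the claim is false. Such enumerations are shown to exist, and the claim is proved for all of them. *)

theory Defs
  imports Complex_Main "HOL-Library.Poly_Mapping"
begin

text \<open>
  Monomials are exponent vectors, so the product of monomials is \<open>+\<close> and the monomial 1 is \<open>0\<close>.
  A polynomial ring \<open>K[v | v \<in> V]\<close> is the subset \<open>polys V\<close> of the polynomials over a type of variables.
\<close>

type_synonym 'v monomial = "'v \<Rightarrow>\<^sub>0 nat"
type_synonym ('v, 'k) mpoly = "'v monomial \<Rightarrow>\<^sub>0 'k"

definition monomials :: "'v set \<Rightarrow> 'v monomial set" where
  "monomials V = {a. Poly_Mapping.keys a \<subseteq> V}"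

definition polys :: "'v set \<Rightarrow> ('v, 'k::field) mpoly set" where
  "polys V = {p. Poly_Mapping.keys p \<subseteq> monomials V}"

definition mon :: "'v monomial \<Rightarrow> ('v, 'k::field) mpoly" where
  "mon a = Poly_Mapping.single a 1"

definition X :: "'v \<Rightarrow> ('v, 'k::field) mpoly" where
  "X v = mon (Poly_Mapping.single v 1)"

definition divides :: "'v monomial \<Rightarrow> 'v monomial \<Rightarrow> bool" where
  "divides a b \<longleftrightarrow> (\<exists>c. b = a + c)"

definition mdeg :: "'v monomial \<Rightarrow> nat" where
  "mdeg a = (\<Sum>v\<in>Poly_Mapping.keys a. Poly_Mapping.lookup a v)"

definition quadratic :: "('v, 'k::field) mpoly \<Rightarrow> bool" where
  "quadratic p \<longleftrightarrow> p \<noteq> 0 \<and> (\<forall>a\<in>Poly_Mapping.keys p. mdeg a = 2)"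

definition alg_hom :: "('v \<Rightarrow> ('w, 'k::field) mpoly) \<Rightarrow> ('v, 'k) mpoly \<Rightarrow> ('w, 'k) mpoly" where
  "alg_hom f p = (\<Sum>a\<in>Poly_Mapping.keys p. Poly_Mapping.single 0 (Poly_Mapping.lookup p a) *
     (\<Prod>v\<in>Poly_Mapping.keys a. f v ^ Poly_Mapping.lookup a v))"

definition ideal_generated :: "'v set \<Rightarrow> ('v, 'k::field) mpoly set \<Rightarrow> ('v, 'k) mpoly set" where
  "ideal_generated V S =
     {(\<Sum>s\<in>F. q s * s) | F q. finite F \<and> F \<subseteq> S \<and> (\<forall>s\<in>F. q s \<in> polys V)}"


subsection \<open>Monomial orders and Groebner bases\<close>

definition monomial_order :: "'v set \<Rightarrow> ('v monomial \<Rightarrow> 'v monomial \<Rightarrow> bool) \<Rightarrow> bool" where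
  "monomial_order V lt \<longleftrightarrow>
     irreflp_on (monomials V) lt \<and> transp_on (monomials V) lt \<and> totalp_on (monomials V) lt \<and>
     (\<forall>a\<in>monomials V. a \<noteq> 0 \<longrightarrow> lt 0 a) \<and>
     (\<forall>a\<in>monomials V. \<forall>b\<in>monomials V. \<forall>c\<in>monomials V. lt a b \<longrightarrow> lt (a + c) (b + c))"

definition init :: "('v monomial \<Rightarrow> 'v monomial \<Rightarrow> bool) \<Rightarrow> ('v, 'k::field) mpoly \<Rightarrow> 'v monomial" where
  "init lt p = (THE a. a \<in> Poly_Mapping.keys p \<and> (\<forall>b\<in>Poly_Mapping.keys p. b \<noteq> a \<longrightarrow> lt b a))"

definition initial_ideal ::
  "'v set \<Rightarrow> ('v monomial \<Rightarrow> 'v monomial \<Rightarrow> bool) \<Rightarrow> ('v, 'k::field) mpoly set \<Rightarrow> ('v, 'k) mpoly set" where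
  "initial_ideal V lt I = ideal_generated V ((\<lambda>f. mon (init lt f)) ` (I - {0}))"

definition groebner_basis ::
  "'v set \<Rightarrow> ('v monomial \<Rightarrow> 'v monomial \<Rightarrow> bool) \<Rightarrow> ('v, 'k::field) mpoly set \<Rightarrow> ('v, 'k) mpoly set \<Rightarrow> bool" where
  "groebner_basis V lt I G \<longleftrightarrow>
     finite G \<and> G \<subseteq> I - {0} \<and>
     initial_ideal V lt I = ideal_generated V ((\<lambda>g. mon (init lt g)) ` G)"

definition reduced_groebner_basis ::
  "'v set \<Rightarrow> ('v monomial \<Rightarrow> 'v monomial \<Rightarrow> bool) \<Rightarrow> ('v, 'k::field) mpoly set \<Rightarrow> ('v, 'k) mpoly set \<Rightarrow> bool" where
  "reduced_groebner_basis V lt I G \<longleftrightarrow>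
     groebner_basis V lt I G \<and>
     (\<forall>g\<in>G. Poly_Mapping.lookup g (init lt g) = 1) \<and>
     (\<forall>g\<in>G. \<forall>h\<in>G. g \<noteq> h \<longrightarrow> (\<forall>a\<in>Poly_Mapping.keys g. \<not> divides (init lt h) a))"

definition standard ::
  "('v monomial \<Rightarrow> 'v monomial \<Rightarrow> bool) \<Rightarrow> ('v, 'k::field) mpoly set \<Rightarrow> 'v monomial \<Rightarrow> bool" where
  "standard lt G a \<longleftrightarrow> (\<forall>g\<in>G. \<not> divides (init lt g) a)"

text \<open>One division step cancels an arbitrary term of \<open>f\<close> by a multiple of an element of \<open>G\<close>.\<close>

definition reduces ::
  "('v monomial \<Rightarrow> 'v monomial \<Rightarrow> bool) \<Rightarrow> ('v, 'k::field) mpoly set \<Rightarrow> ('v, 'k) mpoly \<Rightarrow> ('v, 'k) mpoly \<Rightarrow> bool" where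
  "reduces lt G f f' \<longleftrightarrow> (\<exists>g\<in>G. \<exists>c.
     Poly_Mapping.lookup f (init lt g + c) \<noteq> 0 \<and>
     f' = f - Poly_Mapping.single c
                (Poly_Mapping.lookup f (init lt g + c) / Poly_Mapping.lookup g (init lt g)) * g)"

definition normal_form ::
  "('v monomial \<Rightarrow> 'v monomial \<Rightarrow> bool) \<Rightarrow> ('v, 'k::field) mpoly set \<Rightarrow> ('v, 'k) mpoly \<Rightarrow> ('v, 'k) mpoly \<Rightarrow> bool" where
  "normal_form lt G f r \<longleftrightarrow>
     (reduces lt G)\<^sup>*\<^sup>* f r \<and> (\<forall>a\<in>Poly_Mapping.keys r. standard lt G a)"


subsection \<open>Configurations and toric ideals\<close>

definition configuration :: "'v set \<Rightarrow> 'v monomial set \<Rightarrow> bool" where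
  "configuration V A \<longleftrightarrow> finite A \<and> A \<subseteq> monomials V \<and>
     (\<exists>w :: 'v \<Rightarrow> real. (\<forall>v\<in>V. 0 \<le> w v) \<and>
        (\<forall>a\<in>A. (\<Sum>v\<in>V. w v * real (Poly_Mapping.lookup a v)) = 1))"

text \<open>
  The configuration is given by an injective family of monomials \<open>f v\<close>, \<open>v \<in> V\<close>, which also
  names the variables: this is the kernel of \<open>K[x\<^sub>v | v \<in> V] \<rightarrow> K[t]\<close>, \<open>x\<^sub>v \<mapsto> f v\<close>.
\<close>

definition toric_ideal :: "'v set \<Rightarrow> ('v \<Rightarrow> 'w monomial) \<Rightarrow> ('v, 'k::field) mpoly set" where
  "toric_ideal V f = {p \<in> polys V. alg_hom (\<lambda>v. mon (f v)) p = 0}"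


subsection \<open>Nested configurations\<close>

text \<open>
  The variables of \<open>K[t]\<close> are \<open>1, \<dots>, d\<close>. The variable \<open>l\<close> of the \<open>i\<close>-th ring \<open>K[u]\<close> is the pair \<open>(i, l)\<close>,
  and \<open>m i j\<close>, \<open>1 \<le> j \<le> lam i\<close>, are the monomials of the \<open>i\<close>-th inner configuration. A product
  of \<open>m i\<^sub>k j\<^sub>k\<close>, \<open>1 \<le> k \<le> r\<close>, is represented by the list of pairs \<open>(i\<^sub>k, j\<^sub>k)\<close>.
  The variables of \<open>K[y]\<close> are the nondecreasing lists \<open>[i\<^sub>1, \<dots>, i\<^sub>r]\<close>, those of \<open>K[x]\<close> are
  the monomials of the nested configuration.
\<close>

definition tmon :: "nat list \<Rightarrow> nat monomial" where
  "tmon is = (\<Sum>i\<leftarrow>is. Poly_Mapping.single i 1)"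

definition yvars :: "nat \<Rightarrow> nat monomial set \<Rightarrow> nat list set" where
  "yvars d A = {is. is \<noteq> [] \<and> set is \<subseteq> {1..d} \<and> sorted is \<and> tmon is \<in> A}"

definition expression ::
  "nat \<Rightarrow> nat monomial set \<Rightarrow> (nat \<Rightarrow> nat) \<Rightarrow> (nat \<Rightarrow> nat \<Rightarrow> (nat \<times> nat) monomial) \<Rightarrow>
   (nat \<times> nat) list \<Rightarrow> (nat \<times> nat) monomial \<Rightarrow> bool" where
  "expression d A lam m es M \<longleftrightarrow>
     es \<noteq> [] \<and> (\<forall>(i, j)\<in>set es. i \<in> {1..d} \<and> j \<in> {1..lam i}) \<and>
     tmon (map fst es) \<in> A \<and> M = (\<Sum>(i, j)\<leftarrow>es. m i j)"

definition nested ::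
  "nat \<Rightarrow> nat monomial set \<Rightarrow> (nat \<Rightarrow> nat) \<Rightarrow> (nat \<Rightarrow> nat \<Rightarrow> (nat \<times> nat) monomial) \<Rightarrow>
   (nat \<times> nat) monomial set" where
  "nested d A lam m = {M. \<exists>es. expression d A lam m es M}"

definition zpart :: "nat \<Rightarrow> (nat \<times> nat) list \<Rightarrow> nat monomial" where
  "zpart i es = (\<Sum>(k, j)\<leftarrow>filter (\<lambda>e. fst e = i) es. Poly_Mapping.single j 1)"

definition standard_expression ::
  "nat \<Rightarrow> nat monomial set \<Rightarrow> (nat \<Rightarrow> nat) \<Rightarrow> (nat \<Rightarrow> nat \<Rightarrow> (nat \<times> nat) monomial) \<Rightarrow>
   (nat \<Rightarrow> nat monomial \<Rightarrow> nat monomial \<Rightarrow> bool) \<Rightarrow> (nat \<Rightarrow> (nat, 'k::field) mpoly set) \<Rightarrow>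
   (nat \<times> nat) list \<Rightarrow> (nat \<times> nat) monomial \<Rightarrow> bool" where
  "standard_expression d A lam m lt G es M \<longleftrightarrow>
     expression d A lam m es M \<and> (\<forall>i\<in>{1..d}. standard (lt i) (G i) (zpart i es))"

text \<open>
  The standard expression is unique up to the order of its factors, and nothing below
  depends on which of the orders with \<open>i\<^sub>1 \<le> \<dots> \<le> i\<^sub>r\<close> is selected.
\<close>

definition std_expr ::
  "nat \<Rightarrow> nat monomial set \<Rightarrow> (nat \<Rightarrow> nat) \<Rightarrow> (nat \<Rightarrow> nat \<Rightarrow> (nat \<times> nat) monomial) \<Rightarrow>
   (nat \<Rightarrow> nat monomial \<Rightarrow> nat monomial \<Rightarrow> bool) \<Rightarrow> (nat \<Rightarrow> (nat, 'k::field) mpoly set) \<Rightarrow>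
   (nat \<times> nat) monomial \<Rightarrow> (nat \<times> nat) list" where
  "std_expr d A lam m lt G M =
     (SOME es. standard_expression d A lam m lt G es M \<and> sorted (map fst es))"

definition pi0 :: "(nat list, 'k::field) mpoly \<Rightarrow> (nat, 'k) mpoly" where
  "pi0 = alg_hom (\<lambda>is. mon (tmon is))"

definition phi0 ::
  "nat \<Rightarrow> nat monomial set \<Rightarrow> (nat \<Rightarrow> nat) \<Rightarrow> (nat \<Rightarrow> nat \<Rightarrow> (nat \<times> nat) monomial) \<Rightarrow>
   (nat \<Rightarrow> nat monomial \<Rightarrow> nat monomial \<Rightarrow> bool) \<Rightarrow> (nat \<Rightarrow> (nat, 'k::field) mpoly set) \<Rightarrow>
   ((nat \<times> nat) monomial, 'k) mpoly \<Rightarrow> (nat list, 'k) mpoly" where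
  "phi0 d A lam m lt G = alg_hom (\<lambda>M. X (map fst (std_expr d A lam m lt G M)))"

definition phi ::
  "nat \<Rightarrow> nat monomial set \<Rightarrow> (nat \<Rightarrow> nat) \<Rightarrow> (nat \<Rightarrow> nat \<Rightarrow> (nat \<times> nat) monomial) \<Rightarrow>
   (nat \<Rightarrow> nat monomial \<Rightarrow> nat monomial \<Rightarrow> bool) \<Rightarrow> (nat \<Rightarrow> (nat, 'k::field) mpoly set) \<Rightarrow>
   nat \<Rightarrow> ((nat \<times> nat) monomial, 'k) mpoly \<Rightarrow> (nat, 'k) mpoly" where
  "phi d A lam m lt G i = alg_hom (\<lambda>M. mon (zpart i (std_expr d A lam m lt G M)))"

text \<open>
  The order \<open>\<le>\<close> that \<^theory>\<open>HOL-Library.Poly_Mapping\<close> puts on \<^typ>\<open>nat monomial\<close> compares at the least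
  index where the exponents differ: it is the lexicographic order with \<open>t\<^sub>1 > t\<^sub>2 > \<dots>\<close>.
\<close>

definition lex_ge :: "(nat, 'k::field) mpoly \<Rightarrow> (nat, 'k) mpoly \<Rightarrow> bool" where
  "lex_ge p q \<longleftrightarrow> (\<exists>a b. p = mon a \<and> q = mon b \<and> b \<le> a)"

definition enumeration ::
  "nat \<Rightarrow> nat monomial set \<Rightarrow> (nat \<Rightarrow> nat) \<Rightarrow> (nat \<Rightarrow> nat \<Rightarrow> (nat \<times> nat) monomial) \<Rightarrow>
   (nat \<Rightarrow> nat monomial \<Rightarrow> nat monomial \<Rightarrow> bool) \<Rightarrow> (nat \<Rightarrow> (nat, 'k::field) mpoly set) \<Rightarrow>
   (nat \<Rightarrow> (nat \<times> nat) monomial) \<Rightarrow> bool" where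
  "enumeration d A lam m lt G Ms \<longleftrightarrow>
     bij_betw Ms {1..card (nested d A lam m)} (nested d A lam m) \<and>
     (\<forall>\<alpha>\<in>{1..card (nested d A lam m)}. \<forall>\<beta>\<in>{1..card (nested d A lam m)}. \<alpha> \<le> \<beta> \<longrightarrow>
        lex_ge (pi0 (phi0 d A lam m lt G (X (Ms \<alpha>)))) (pi0 (phi0 d A lam m lt G (X (Ms \<beta>)))))"

definition aligned :: "(nat \<times> nat) list \<Rightarrow> (nat \<times> nat) list \<Rightarrow> bool" where
  "aligned es fs \<longleftrightarrow> (\<forall>(i, j)\<in>set es. \<forall>(k, l)\<in>set fs. i = k \<longrightarrow> j \<le> l)"

text \<open>
  The lexicographic condition does not say how monomials with the same image under \<open>\<pi>\<^sub>0 \<circ> \<phi>\<^sub>0\<close> are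
  enumerated. Not every choice will do: for \<open>A = {t\<^sub>1\<^sup>2}\<close> and four variables \<open>m\<^sub>1, \<dots>, m\<^sub>4\<close> as inner
  configuration, all ten monomials \<open>m\<^sub>j m\<^sub>l\<close> are tied, and if \<open>m\<^sub>3 m\<^sub>4\<close> precedes \<open>m\<^sub>1 m\<^sub>2\<close>, no binomial
  of degree \<open>m\<^sub>1 m\<^sub>2 m\<^sub>3 m\<^sub>4\<close> satisfies \<open>related\<close> below. Ties have to respect \<open>aligned\<close>.
\<close>

definition ties_aligned ::
  "nat \<Rightarrow> nat monomial set \<Rightarrow> (nat \<Rightarrow> nat) \<Rightarrow> (nat \<Rightarrow> nat \<Rightarrow> (nat \<times> nat) monomial) \<Rightarrow>
   (nat \<Rightarrow> nat monomial \<Rightarrow> nat monomial \<Rightarrow> bool) \<Rightarrow> (nat \<Rightarrow> (nat, 'k::field) mpoly set) \<Rightarrow>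
   (nat \<Rightarrow> (nat \<times> nat) monomial) \<Rightarrow> bool" where
  "ties_aligned d A lam m lt G Ms \<longleftrightarrow>
     (\<forall>\<alpha>\<in>{1..card (nested d A lam m)}. \<forall>\<beta>\<in>{1..card (nested d A lam m)}.
        pi0 (phi0 d A lam m lt G (X (Ms \<alpha>))) = pi0 (phi0 d A lam m lt G (X (Ms \<beta>))) \<and>
        aligned (std_expr d A lam m lt G (Ms \<alpha>)) (std_expr d A lam m lt G (Ms \<beta>)) \<longrightarrow> \<alpha> \<le> \<beta>)"

definition quad_binomial ::
  "(nat \<Rightarrow> (nat \<times> nat) monomial) \<Rightarrow> nat \<Rightarrow> nat \<Rightarrow> nat \<Rightarrow> nat \<Rightarrow>
   ((nat \<times> nat) monomial, 'k::field) mpoly" where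
  "quad_binomial Ms \<alpha> \<beta> \<gamma> \<delta> = X (Ms \<alpha>) * X (Ms \<beta>) - X (Ms \<gamma>) * X (Ms \<delta>)"

definition related ::
  "nat \<Rightarrow> nat monomial set \<Rightarrow> (nat \<Rightarrow> nat) \<Rightarrow> (nat \<Rightarrow> nat \<Rightarrow> (nat \<times> nat) monomial) \<Rightarrow>
   (nat list monomial \<Rightarrow> nat list monomial \<Rightarrow> bool) \<Rightarrow> (nat list, 'k::field) mpoly set \<Rightarrow>
   (nat \<Rightarrow> nat monomial \<Rightarrow> nat monomial \<Rightarrow> bool) \<Rightarrow> (nat \<Rightarrow> (nat, 'k) mpoly set) \<Rightarrow>
   (nat \<Rightarrow> (nat \<times> nat) monomial) \<Rightarrow> nat \<Rightarrow> nat \<Rightarrow> nat \<Rightarrow> nat \<Rightarrow> bool" where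
  "related d A lam m lt0 G0 lt G Ms \<alpha> \<beta> \<gamma> \<delta> \<longleftrightarrow>
     {\<alpha>, \<beta>, \<gamma>, \<delta>} \<subseteq> {1..card (nested d A lam m)} \<and> \<gamma> \<le> \<delta> \<and>
     normal_form lt0 G0 (phi0 d A lam m lt G (X (Ms \<alpha>) * X (Ms \<beta>)))
                        (phi0 d A lam m lt G (X (Ms \<gamma>) * X (Ms \<delta>))) \<and>
     (\<forall>i\<in>{1..d}. normal_form (lt i) (G i) (phi d A lam m lt G i (X (Ms \<alpha>) * X (Ms \<beta>)))
                                           (phi d A lam m lt G i (X (Ms \<gamma>) * X (Ms \<delta>)))) \<and>
     aligned (std_expr d A lam m lt G (Ms \<gamma>)) (std_expr d A lam m lt G (Ms \<delta>))"

definition nested_binomials ::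
  "nat \<Rightarrow> nat monomial set \<Rightarrow> (nat \<Rightarrow> nat) \<Rightarrow> (nat \<Rightarrow> nat \<Rightarrow> (nat \<times> nat) monomial) \<Rightarrow>
   (nat list monomial \<Rightarrow> nat list monomial \<Rightarrow> bool) \<Rightarrow> (nat list, 'k::field) mpoly set \<Rightarrow>
   (nat \<Rightarrow> nat monomial \<Rightarrow> nat monomial \<Rightarrow> bool) \<Rightarrow> (nat \<Rightarrow> (nat, 'k) mpoly set) \<Rightarrow>
   (nat \<Rightarrow> (nat \<times> nat) monomial) \<Rightarrow> ((nat \<times> nat) monomial, 'k) mpoly set" where
  "nested_binomials d A lam m lt0 G0 lt G Ms =
     {quad_binomial Ms \<alpha> \<beta> \<gamma> \<delta> | \<alpha> \<beta> \<gamma> \<delta>. related d A lam m lt0 G0 lt G Ms \<alpha> \<beta> \<gamma> \<delta>} - {0}"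

end

theory Submission
  imports Defs "HOL-Library.Multiset" "HOL-Library.Product_Lexorder"
begin

text \<open>
  Let \<open>\<phi>\<^sub>0, \<dots>, \<phi>\<^sub>d\<close> send a monomial \<open>u\<close> of \<open>K[x]\<close> to monomials of \<open>K[y]\<close> and of the inner rings. They
  do not factor through \<open>\<pi>\<close>, but they nearly do. The blocks of variables of the inner configurations
  are disjoint, so \<open>\<pi> u = \<pi> v\<close> holds exactly if \<open>\<phi>\<^sub>i u\<close> and \<open>\<phi>\<^sub>i v\<close> lie in the same fiber of \<open>\<pi>\<^sub>i\<close> for all
  \<open>i \<ge> 1\<close> (\<open>same_product_iff\<close>). Fibers of a configuration are homogeneous, and the degree of \<open>\<phi>\<^sub>i u\<close> is
  the exponent of \<open>t\<^sub>i\<close> in \<open>\<pi>\<^sub>0 (\<phi>\<^sub>0 u)\<close>; so \<open>\<phi>\<^sub>0 u\<close> and \<open>\<phi>\<^sub>0 v\<close> then lie in the same fiber of \<open>\<pi>\<^sub>0\<close>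
  (\<open>same_product_shapes\<close>). Every fiber of a toric ideal with a Groebner basis contains exactly one
  standard monomial, namely its least element. Hence two monomials of one fiber of \<open>\<pi>\<close> whose images
  under all \<open>\<phi>\<^sub>j\<close> are standard have the same images under all \<open>\<phi>\<^sub>j\<close> (\<open>standard_parts_eq\<close>).

  What the images \<open>\<phi>\<^sub>j u\<close> leave open is how the factors \<open>m\<^sub>j\<^sup>(\<^sup>i\<^sup>)\<close> are distributed among the variables of
  \<open>u\<close>. That is where the alignment condition enters. If the variables of \<open>u\<close> are listed in
  the order of the enumeration and are pairwise aligned, then the first variable has the
  lexicographically greatest shape and takes, for each \<open>i\<close>, the smallest indices \<open>j\<close> available. So it
  is determined by the \<open>\<phi>\<^sub>j u\<close>, and by induction so is \<open>u\<close> (\<open>pairwise_aligned_unique\<close>).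

  A pair of variables can always be brought into this form: take the standard monomials in the fibers
  of the \<open>\<phi>\<^sub>j\<close>-images and redistribute the factors (\<open>ex_related\<close>). Because all \<open>\<G>\<^sub>j\<close> are quadratic, a
  monomial has standard images and is pairwise aligned as soon as all products of two of its variables
  are (\<open>standard_binomials\<close>). Consequently a monomial divisible by no \<open>x\<^sub>\<alpha> x\<^sub>\<beta>\<close> that starts a
  binomial is the only one of its kind in its fiber, and this is the Groebner basis property
  (\<open>groebner_basis_criterion\<close>).

  It remains to find a monomial order that makes \<open>x\<^sub>\<alpha> x\<^sub>\<beta>\<close> initial. Compare \<open>\<phi>\<^sub>0, \<dots>, \<phi>\<^sub>d\<close> one after
  the other by the given orders: passing to normal forms never increases any of them. If all of them
  agree, only the distribution of factors has changed. Give every variable a number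
  \<open>\<kappa>\<close> that is larger for a lexicographically smaller shape and, within one shape, for a larger sum of
  the indices \<open>j\<close>. Aligning two variables keeps the sum of their \<open>\<kappa>\<close> and moves the two values apart, so it increases the sum
  of the \<open>\<kappa>\<^sup>2\<close> (\<open>key_squares_less\<close>). This gives the tie-break, and the same \<open>\<kappa>\<close>, used as a sorting key,
  produces an admissible enumeration (\<open>ex_enumeration\<close>).
\<close>


section \<open>Monomials and monomial maps\<close>

abbreviation var :: "'v \<Rightarrow> 'v monomial" where
  "var v \<equiv> Poly_Mapping.single v 1"

text \<open>
  The additive extension of a map on variables to monomials. With monomials as values it is a
  monomial homomorphism such as \<open>\<pi>\<close> or \<open>\<phi>\<^sub>j\<close>; with numbers it is a weight, and with multisets it collects
  the factors of a product. Repeated addition replaces scalar multiplication, so that one definition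
  serves all these monoids.
\<close>

definition extend :: "('v \<Rightarrow> 'a::comm_monoid_add) \<Rightarrow> 'v monomial \<Rightarrow> 'a" where
  "extend h a = (\<Sum>v\<in>Poly_Mapping.keys a. \<Sum>k<Poly_Mapping.lookup a v. h v)"

lemma extend_superset:
  assumes "finite S" "Poly_Mapping.keys a \<subseteq> S"
  shows "extend h a = (\<Sum>v\<in>S. \<Sum>k<Poly_Mapping.lookup a v. h v)"
  unfolding extend_def using assms
  by (intro sum.mono_neutral_left) (auto simp: in_keys_iff)

lemma extend_zero [simp]: "extend h 0 = 0"
  by (simp add: extend_def)

lemma extend_add [simp]:
  fixes h :: "'v \<Rightarrow> 'a::comm_monoid_add"
  shows "extend h (a + b) = extend h a + extend h b"
proof -
  let ?S = "Poly_Mapping.keys a \<union> Poly_Mapping.keys b"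
  have split: "(\<Sum>k<m + n. x) = (\<Sum>k<m. x) + (\<Sum>k<n. x)" for m n :: nat and x :: 'a
    by (induction n) (simp_all add: add.assoc)
  have "extend h (a + b) = (\<Sum>v\<in>?S. \<Sum>k<Poly_Mapping.lookup (a + b) v. h v)"
    by (rule extend_superset) (use keys_add[of a b] in auto)
  also have "\<dots> = (\<Sum>v\<in>?S. \<Sum>k<Poly_Mapping.lookup a v. h v) + (\<Sum>v\<in>?S. \<Sum>k<Poly_Mapping.lookup b v. h v)"
    by (simp add: lookup_add split sum.distrib)
  also have "\<dots> = extend h a + extend h b"
    by (simp add: extend_superset[of ?S])
  finally show ?thesis .
qed

lemma extend_var [simp]: "extend h (Poly_Mapping.single v (Suc 0)) = h v"
  by (simp add: extend_def)

lemma monomials_zero [simp]: "0 \<in> monomials V"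
  by (simp add: monomials_def)

lemma monomials_add [simp]: "a + b \<in> monomials V \<longleftrightarrow> a \<in> monomials V \<and> b \<in> monomials V"
proof -
  have "Poly_Mapping.keys (a + b) = Poly_Mapping.keys a \<union> Poly_Mapping.keys b"
    by (auto simp: in_keys_iff lookup_add)
  then show ?thesis
    by (auto simp: monomials_def)
qed

lemma monomials_var [simp]: "Poly_Mapping.single v (Suc 0) \<in> monomials V \<longleftrightarrow> v \<in> V"
  by (simp add: monomials_def)

lemma split_var:
  assumes "v \<in> Poly_Mapping.keys a"
  obtains b where "a = var v + b"
proof
  show "a = var v + (a - var v)"
    using assms by (intro poly_mapping_eqI) (auto simp: lookup_add lookup_minus lookup_single when_def in_keys_iff)
qed

lemma nonzero_monomialE:
  assumes "a \<noteq> 0"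
  obtains v b where "a = var v + b"
proof -
  obtain v where "v \<in> Poly_Mapping.keys a"
    using assms by (metis keys_eq_empty equals0I)
  then obtain b where "a = var v + b" by (rule split_var)
  then show thesis by (rule that)
qed

lemma mdeg_eq_extend: "mdeg a = extend (\<lambda>_. 1) a"
  by (simp add: mdeg_def extend_def)

lemma mdeg_zero [simp]: "mdeg 0 = 0"
  and mdeg_add [simp]: "mdeg (a + b) = mdeg a + mdeg b"
  and mdeg_var [simp]: "mdeg (Poly_Mapping.single v (Suc 0)) = 1"
  by (simp_all add: mdeg_eq_extend)

lemma monomial_induct [consumes 1, case_names zero var]:
  assumes "a \<in> monomials V" "P 0"
    and "\<And>v b. v \<in> V \<Longrightarrow> b \<in> monomials V \<Longrightarrow> P b \<Longrightarrow> P (var v + b)"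
  shows "P a"
  using assms(1)
proof (induction "mdeg a" arbitrary: a rule: less_induct)
  case less
  show ?case
  proof (cases "a = 0")
    case False
    then obtain v b where b: "a = var v + b"
      by (rule nonzero_monomialE)
    with less.prems have "v \<in> V" "b \<in> monomials V" by auto
    moreover from this have "P b" using less.hyps b by simp
    ultimately show ?thesis
      unfolding b by (rule assms(3))
  qed (simp add: assms(2))
qed

lemma extend_monomials: "a \<in> monomials V \<Longrightarrow> (\<And>v. v \<in> V \<Longrightarrow> h v \<in> monomials W) \<Longrightarrow> extend h a \<in> monomials W"
  by (induction rule: monomial_induct) simp_all

lemma mdeg_eq_0 [simp]: "mdeg a = 0 \<longleftrightarrow> a = 0"
  by (auto simp: mdeg_def in_keys_iff intro!: poly_mapping_eqI)

lemma mdeg_one: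
  assumes "mdeg a = 1"
  obtains v where "a = var v"
proof -
  have "a \<noteq> 0" using assms by auto
  then obtain v b where "a = var v + b"
    by (rule nonzero_monomialE)
  moreover from this assms have "b = 0" by simp
  ultimately show thesis using that by simp
qed

lemma mdeg_two:
  assumes "mdeg a = 2"
  obtains v w where "a = var v + var w"
proof -
  have "a \<noteq> 0" using assms by auto
  then obtain v b where b: "a = var v + b"
    by (rule nonzero_monomialE)
  with assms have "mdeg b = 1" by simp
  then obtain w where "b = var w" by (rule mdeg_one)
  with b show thesis by (simp add: that)
qed

lemma finite_monomials_of_degree:
  assumes "finite V"
  shows "finite {a \<in> monomials V. mdeg a = n}"
proof (induction n)
  case 0
  have "{a \<in> monomials V. mdeg a = 0} \<subseteq> {0}" by auto
  then show ?case by (rule finite_subset) simp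
next
  case (Suc n)
  have "{a \<in> monomials V. mdeg a = Suc n} \<subseteq> (\<lambda>(v, b). var v + b) ` (V \<times> {a \<in> monomials V. mdeg a = n})"
  proof safe
    fix a assume "a \<in> monomials V" "mdeg a = Suc n"
    then have "a \<noteq> 0" by auto
    then obtain v b where "a = var v + b"
      by (rule nonzero_monomialE)
    with \<open>a \<in> monomials V\<close> \<open>mdeg a = Suc n\<close> have "(v, b) \<in> V \<times> {a \<in> monomials V. mdeg a = n}" by simp
    with \<open>a = var v + b\<close> show "a \<in> (\<lambda>(v, b). var v + b) ` (V \<times> {a \<in> monomials V. mdeg a = n})"
      by (intro image_eqI[of _ _ "(v, b)"]) simp_all
  qed
  then show ?case
    by (rule finite_subset) (use Suc assms in simp)
qed

section \<open>Polynomials\<close>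

lemma mon_add: "mon (a + b) = mon a * mon b"
  by (simp add: mon_def mult_single)

lemma mon_zero: "mon 0 = 1"
  by (simp add: mon_def)

lemma mon_inject [simp]: "(mon a :: ('v, 'k::field) mpoly) = mon b \<longleftrightarrow> a = b"
  unfolding mon_def by (metis keys_single singleton_inject zero_neq_one)

lemma keys_mon [simp]: "Poly_Mapping.keys (mon a :: ('v, 'k::field) mpoly) = {a}"
  by (simp add: mon_def)

lemma lookup_mon: "Poly_Mapping.lookup (mon a) b = (1 when a = b)"
  by (simp add: mon_def lookup_single)

lemma poly_eq_sum_monomials: "p = (\<Sum>a\<in>Poly_Mapping.keys p. Poly_Mapping.single a (Poly_Mapping.lookup p a))"
proof (rule poly_mapping_eqI)
  fix b
  have "(\<Sum>a\<in>Poly_Mapping.keys p. Poly_Mapping.lookup p a when a = b) = Poly_Mapping.lookup p b"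
    by (cases "b \<in> Poly_Mapping.keys p") (auto simp: when_def in_keys_iff)
  then show "Poly_Mapping.lookup p b = Poly_Mapping.lookup (\<Sum>a\<in>Poly_Mapping.keys p. Poly_Mapping.single a (Poly_Mapping.lookup p a)) b"
    by (simp add: lookup_sum lookup_single)
qed

lemma polysD: "p \<in> polys V \<Longrightarrow> a \<in> Poly_Mapping.keys p \<Longrightarrow> a \<in> monomials V"
  by (auto simp: polys_def)

lemma polys_zero [simp]: "0 \<in> polys V"
  by (simp add: polys_def)

lemma polys_single: "a \<in> monomials V \<Longrightarrow> Poly_Mapping.single a c \<in> polys V"
  by (simp add: polys_def)

lemma polys_mon [simp]: "mon a \<in> polys V \<longleftrightarrow> a \<in> monomials V"
  by (simp add: polys_def)

lemma polys_add: "p \<in> polys V \<Longrightarrow> q \<in> polys V \<Longrightarrow> p + q \<in> polys V"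
  unfolding polys_def using keys_add[of p q] by auto

lemma polys_diff:
  fixes p q :: "('v, 'k::field) mpoly"
  shows "p \<in> polys V \<Longrightarrow> q \<in> polys V \<Longrightarrow> p - q \<in> polys V"
  unfolding polys_def using keys_diff[of p q] by auto

lemma polys_mult:
  assumes "p \<in> polys V" "q \<in> polys V"
  shows "p * q \<in> polys V"
  unfolding polys_def
proof safe
  fix a assume "a \<in> Poly_Mapping.keys (p * q)"
  then obtain b c where "a = b + c" "b \<in> Poly_Mapping.keys p" "c \<in> Poly_Mapping.keys q"
    using keys_mult[of p q] by blast
  with assms show "a \<in> monomials V" by (auto dest: polysD)
qed

lemma polys_sum: "(\<And>x. x \<in> S \<Longrightarrow> p x \<in> polys V) \<Longrightarrow> sum p S \<in> polys V"
  by (induction S rule: infinite_finite_induct) (simp_all add: polys_add)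

subsection \<open>Monomial ideals\<close>

lemma monomial_ideal_divides:
  assumes "(mon a :: ('v, 'k::field) mpoly) \<in> ideal_generated V (mon ` S)"
  shows "\<exists>s\<in>S. divides s a"
proof -
  obtain F and q :: "('v, 'k) mpoly \<Rightarrow> ('v, 'k) mpoly" where F: "F \<subseteq> mon ` S" and eq: "mon a = (\<Sum>s\<in>F. q s * s)"
    using assms by (auto simp: ideal_generated_def)
  have "a \<in> Poly_Mapping.keys (\<Sum>s\<in>F. q s * s)"
    by (simp flip: eq)
  then obtain t where t: "t \<in> F" "a \<in> Poly_Mapping.keys (q t * t)"
    using keys_sum[of "\<lambda>s. q s * s" F] by blast
  then obtain s where s: "s \<in> S" "t = mon s" using F by blast
  with t obtain c where "a = c + s"
    using keys_mult[of "q t" t] by auto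
  with s show ?thesis by (metis divides_def add.commute)
qed

lemma ideal_generated_mono: "S \<subseteq> S' \<Longrightarrow> ideal_generated V S \<subseteq> ideal_generated V S'"
  unfolding ideal_generated_def by blast

lemma generator_in_ideal_generated: "s \<in> S \<Longrightarrow> s \<in> ideal_generated V S"
  unfolding ideal_generated_def
  by (rule CollectI, rule exI[of _ "{s}"], rule exI[of _ "\<lambda>_. 1"]) (simp add: polys_def monomials_def)

text \<open>
  If each generator of one ideal is a multiple of a generator of another, then substituting and
  collecting the coefficients by the generator used gives the inclusion.
\<close>

lemma ideal_generated_subset:
  fixes S S' :: "('v, 'k::field) mpoly set"
  assumes "\<And>s. s \<in> S \<Longrightarrow> \<exists>c\<in>polys V. \<exists>t\<in>S'. s = c * t"
  shows "ideal_generated V S \<subseteq> ideal_generated V S'"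
proof
  fix p assume "p \<in> ideal_generated V S"
  then obtain F q where F: "finite F" "F \<subseteq> S" and q: "\<forall>s\<in>F. q s \<in> polys V" and p: "p = (\<Sum>s\<in>F. q s * s)"
    by (auto simp: ideal_generated_def)
  have "\<exists>c t. c \<in> polys V \<and> t \<in> S' \<and> s = c * t" if "s \<in> S" for s
    using assms[OF that] by blast
  then obtain c t where c: "\<And>s. s \<in> S \<Longrightarrow> c s \<in> polys V" and t: "\<And>s. s \<in> S \<Longrightarrow> t s \<in> S'"
    and ct: "\<And>s. s \<in> S \<Longrightarrow> s = c s * t s"
    by metis
  have "p = (\<Sum>u\<in>t ` F. \<Sum>s\<in>{s\<in>F. t s = u}. q s * s)"
    unfolding p by (rule sum.image_gen[OF F(1)])
  also have "\<dots> = (\<Sum>u\<in>t ` F. (\<Sum>s\<in>{s\<in>F. t s = u}. q s * c s) * u)"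
    unfolding sum_distrib_right
  proof (intro sum.cong refl)
    fix u s assume "s \<in> {s\<in>F. t s = u}"
    then have s: "s \<in> S" "t s = u" using F(2) by auto
    have "s = c s * u" using ct[OF s(1)] unfolding s(2) .
    then have "q s * s = q s * (c s * u)" by (rule arg_cong)
    then show "q s * s = q s * c s * u" by (simp only: mult.assoc)
  qed
  finally show "p \<in> ideal_generated V S'"
    unfolding ideal_generated_def
  proof (intro CollectI exI conjI)
    show "finite (t ` F)" using F(1) by (rule finite_imageI)
    show "t ` F \<subseteq> S'" using F(2) t by blast
    have "q s * c s \<in> polys V" if "s \<in> F" for s
      using polys_mult[of "q s" V "c s"] c[of s] F(2) q that by blast
    then show "\<forall>u\<in>t ` F. (\<Sum>s\<in>{s\<in>F. t s = u}. q s * c s) \<in> polys V"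
      by (auto intro!: polys_sum)
  qed
qed

section \<open>Monomial orders\<close>

lemma monomial_orderD:
  assumes "monomial_order V lt" "a \<in> monomials V"
  shows "\<not> lt a a"
    and "b \<in> monomials V \<Longrightarrow> c \<in> monomials V \<Longrightarrow> lt a b \<Longrightarrow> lt b c \<Longrightarrow> lt a c"
    and "b \<in> monomials V \<Longrightarrow> a \<noteq> b \<Longrightarrow> lt a b \<or> lt b a"
    and "a \<noteq> 0 \<Longrightarrow> lt 0 a"
    and "b \<in> monomials V \<Longrightarrow> c \<in> monomials V \<Longrightarrow> lt a b \<Longrightarrow> lt (a + c) (b + c)"
  using assms unfolding monomial_order_def irreflp_on_def transp_on_def totalp_on_def by blast+

lemma monomial_order_asym:
  assumes "monomial_order V lt" "a \<in> monomials V" "b \<in> monomials V" "lt a b" "lt b a"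
  shows False
  using monomial_orderD(1)[OF assms(1,2)] monomial_orderD(2)[OF assms(1,2,3,2,4,5)] by contradiction

lemma ex_least:
  assumes "monomial_order V lt" "finite S" "S \<noteq> {}" "S \<subseteq> monomials V"
  shows "\<exists>a\<in>S. \<forall>b\<in>S. b \<noteq> a \<longrightarrow> lt a b"
  using assms(2-4)
proof (induction S rule: finite_ne_induct)
  case (insert x F)
  then obtain a where a: "a \<in> F" "\<And>b. b \<in> F \<Longrightarrow> b \<noteq> a \<Longrightarrow> lt a b" by auto
  then have m: "a \<in> monomials V" "x \<in> monomials V" "F \<subseteq> monomials V" using insert by auto
  show ?case
  proof (cases "lt a x")
    case False
    then have "lt x a"
      using monomial_orderD(3)[OF assms(1) m(1) m(2)] a insert by auto
    then have "\<forall>b\<in>F. lt x b"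
      using a(2) monomial_orderD(2)[OF assms(1) m(2,1)] m(3) by blast
    then show ?thesis by blast
  qed (use a in blast)
qed simp

lemma ex_greatest:
  assumes "monomial_order V lt" "finite S" "S \<noteq> {}" "S \<subseteq> monomials V"
  shows "\<exists>a\<in>S. \<forall>b\<in>S. b \<noteq> a \<longrightarrow> lt b a"
  using assms(2-4)
proof (induction S rule: finite_ne_induct)
  case (insert x F)
  then obtain a where a: "a \<in> F" "\<And>b. b \<in> F \<Longrightarrow> b \<noteq> a \<Longrightarrow> lt b a" by auto
  then have m: "a \<in> monomials V" "x \<in> monomials V" "F \<subseteq> monomials V" using insert by auto
  show ?case
  proof (cases "lt x a")
    case False
    then have "lt a x"
      using monomial_orderD(3)[OF assms(1) m(1) m(2)] a insert by auto
    then have "\<forall>b\<in>F. lt b x"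
      using a(2) monomial_orderD(2)[OF assms(1) _ m(1,2)] m(3) by blast
    then show ?thesis by blast
  qed (use a in blast)
qed simp

lemma init_eqI:
  assumes "monomial_order V lt" "p \<in> polys V" "a \<in> Poly_Mapping.keys p"
    and "\<And>b. b \<in> Poly_Mapping.keys p \<Longrightarrow> b \<noteq> a \<Longrightarrow> lt b a"
  shows "init lt p = a"
  unfolding init_def
proof (rule the_equality)
  fix a' assume a': "a' \<in> Poly_Mapping.keys p \<and> (\<forall>b\<in>Poly_Mapping.keys p. b \<noteq> a' \<longrightarrow> lt b a')"
  with assms(2,3) have "a \<in> monomials V" "a' \<in> monomials V" by (auto dest: polysD)
  moreover have "lt a a'" "lt a' a" if "a' \<noteq> a"
    using a' assms(3,4) that by auto
  ultimately show "a' = a"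
    using monomial_orderD(1,2)[OF assms(1) \<open>a \<in> monomials V\<close>] by blast
qed (use assms in auto)

lemma init_greatest:
  assumes "monomial_order V lt" "p \<in> polys V" "p \<noteq> 0"
  shows "init lt p \<in> Poly_Mapping.keys p"
    and "b \<in> Poly_Mapping.keys p \<Longrightarrow> b \<noteq> init lt p \<Longrightarrow> lt b (init lt p)"
proof -
  obtain a where a: "a \<in> Poly_Mapping.keys p" "\<forall>b\<in>Poly_Mapping.keys p. b \<noteq> a \<longrightarrow> lt b a"
    using ex_greatest[OF assms(1), of "Poly_Mapping.keys p"] assms by (auto simp: polys_def)
  with init_eqI[OF assms(1,2) a(1)] have "init lt p = a" by blast
  with a show "init lt p \<in> Poly_Mapping.keys p"
    and "b \<in> Poly_Mapping.keys p \<Longrightarrow> b \<noteq> init lt p \<Longrightarrow> lt b (init lt p)" by auto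
qed

lemma lex_monomial_order: "monomial_order (V :: 'v::linorder set) (<)"
proof -
  have "0 < a" if "a \<noteq> 0" for a :: "'v monomial"
  proof -
    let ?k = "Min (Poly_Mapping.keys a)"
    have "?k \<in> Poly_Mapping.keys a" using that by (intro Min_in) auto
    moreover have "Poly_Mapping.lookup a k' = 0" if "k' < ?k" for k'
      using that by (metis Min_le finite_keys in_keys_iff leD)
    ultimately show ?thesis
      by (auto simp: less_poly_mapping.rep_eq less_fun_def in_keys_iff intro!: exI[of _ ?k])
  qed
  then show ?thesis
    by (auto simp: monomial_order_def irreflp_on_def transp_on_def totalp_on_def)
qed

text \<open>
  Comparing the images under \<open>h\<close> first and using \<open>lt\<close> only for ties. For additive \<open>h\<close> this turns a monomial
  order on the target and one on the source into a monomial order on the source.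
\<close>

definition refine :: "('a \<Rightarrow> 'b) \<Rightarrow> ('b \<Rightarrow> 'b \<Rightarrow> bool) \<Rightarrow> ('a \<Rightarrow> 'a \<Rightarrow> bool) \<Rightarrow> 'a \<Rightarrow> 'a \<Rightarrow> bool" where
  "refine h R lt a b \<longleftrightarrow> R (h a) (h b) \<or> h a = h b \<and> lt a b"

lemma refine_monomial_order:
  assumes lt: "monomial_order V lt" and R: "monomial_order W R" and h: "\<And>v. v \<in> V \<Longrightarrow> h v \<in> monomials W"
  shows "monomial_order V (refine (extend h) R lt)"
proof -
  have m: "extend h a \<in> monomials W" if "a \<in> monomials V" for a
    using that h by (rule extend_monomials)
  show ?thesis
    unfolding monomial_order_def
  proof (intro conjI irreflp_onI transp_onI totalp_onI ballI impI)
    fix a assume "a \<in> monomials V"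
    then show "\<not> refine (extend h) R lt a a"
      using monomial_orderD(1)[OF lt, of a] monomial_orderD(1)[OF R m, of a] by (simp add: refine_def)
  next
    fix a b c assume "a \<in> monomials V" "b \<in> monomials V" "c \<in> monomials V"
      "refine (extend h) R lt a b" "refine (extend h) R lt b c"
    then show "refine (extend h) R lt a c"
      using monomial_orderD(2)[OF lt, of a b c] monomial_orderD(2)[OF R m m m, of a b c]
      by (auto simp: refine_def)
  next
    fix a b assume "a \<in> monomials V" "b \<in> monomials V" "a \<noteq> b"
    then show "refine (extend h) R lt a b \<or> refine (extend h) R lt b a"
      using monomial_orderD(3)[OF lt, of a b] monomial_orderD(3)[OF R m m, of a b]
      unfolding refine_def by metis
  next
    fix a assume "a \<in> monomials V" "a \<noteq> 0"
    then show "refine (extend h) R lt 0 a"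
      using monomial_orderD(4)[OF lt, of a] monomial_orderD(4)[OF R m, of a] by (auto simp: refine_def)
  next
    fix a b c assume "a \<in> monomials V" "b \<in> monomials V" "c \<in> monomials V" "refine (extend h) R lt a b"
    then show "refine (extend h) R lt (a + c) (b + c)"
      using monomial_orderD(5)[OF lt, of a b c] monomial_orderD(5)[OF R m m m, of a b c] by (auto simp: refine_def)
  qed
qed

lemma refine_weight_monomial_order:
  fixes w :: "'v \<Rightarrow> nat"
  assumes "monomial_order V lt"
  shows "monomial_order V (refine (extend w) (<) lt)"
  unfolding monomial_order_def
proof (intro conjI irreflp_onI transp_onI totalp_onI ballI impI)
  fix a b c assume "a \<in> monomials V" "b \<in> monomials V" "c \<in> monomials V"
    "refine (extend w) (<) lt a b" "refine (extend w) (<) lt b c"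
  then show "refine (extend w) (<) lt a c"
    using monomial_orderD(2)[OF assms, of a b c] by (auto simp: refine_def)
next
  fix a b assume "a \<in> monomials V" "b \<in> monomials V" "a \<noteq> b"
  then show "refine (extend w) (<) lt a b \<or> refine (extend w) (<) lt b a"
    using monomial_orderD(3)[OF assms, of a b] by (auto simp: refine_def)
qed (use monomial_orderD(1)[OF assms] monomial_orderD(4)[OF assms] monomial_orderD(5)[OF assms] in \<open>auto simp: refine_def\<close>)

section \<open>Toric ideals\<close>

definition toric_map :: "('v \<Rightarrow> 'w monomial) \<Rightarrow> ('v, 'k::field) mpoly \<Rightarrow> ('w, 'k) mpoly" where
  "toric_map f p = (\<Sum>a\<in>Poly_Mapping.keys p. Poly_Mapping.single (extend f a) (Poly_Mapping.lookup p a))"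

lemma mon_sum: "mon (sum h S) = (\<Prod>x\<in>S. mon (h x))"
  by (induction S rule: infinite_finite_induct) (simp_all add: mon_zero mon_add)

text \<open>
  An algebra homomorphism that sends variables to monomials acts on exponents by \<^const>\<open>extend\<close>.
\<close>

lemma alg_hom_mon:
  fixes f :: "'v \<Rightarrow> 'w monomial" and p :: "('v, 'k::field) mpoly"
  shows "alg_hom (\<lambda>v. mon (f v)) p = toric_map f p"
proof -
  have "(\<Prod>v\<in>Poly_Mapping.keys a. (mon (f v) :: ('w, 'k) mpoly) ^ Poly_Mapping.lookup a v) = mon (extend f a)" for a
    by (simp add: extend_def mon_sum)
  then show ?thesis
    by (simp add: alg_hom_def toric_map_def mult_single mon_def)
qed

lemma toric_map_mon [simp]: "toric_map f (mon a) = mon (extend f a)"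
  by (simp add: toric_map_def mon_def)

lemma toric_map_single: "toric_map f (Poly_Mapping.single a c) = Poly_Mapping.single (extend f a) c"
  by (simp add: toric_map_def)

lemma toric_map_add: "toric_map f (p + q) = toric_map f p + toric_map f q"
  unfolding toric_map_def by (rule setsum_keys_plus_distrib) (simp_all add: single_add)

lemma toric_map_zero [simp]: "toric_map f 0 = 0"
  by (simp add: toric_map_def)

lemma toric_map_diff: "toric_map f (p - q) = toric_map f p - toric_map f q"
  using toric_map_add[of f "p - q" q] by simp

lemma toric_map_sum: "toric_map f (sum p S) = (\<Sum>x\<in>S. toric_map f (p x))"
  by (induction S rule: infinite_finite_induct) (simp_all add: toric_map_add)

lemma toric_map_single_mult: "toric_map f (Poly_Mapping.single a c * p) = Poly_Mapping.single (extend f a) c * toric_map f p"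
proof -
  let ?t = "\<lambda>b. Poly_Mapping.single b (Poly_Mapping.lookup p b)"
  have "toric_map f (Poly_Mapping.single a c * p) = toric_map f (\<Sum>b\<in>Poly_Mapping.keys p. Poly_Mapping.single a c * ?t b)"
    by (subst poly_eq_sum_monomials[of p]) (simp add: sum_distrib_left)
  also have "\<dots> = Poly_Mapping.single (extend f a) c * toric_map f p"
    by (simp add: toric_map_sum toric_map_single mult_single toric_map_def[of f p] sum_distrib_left)
  finally show ?thesis .
qed

lemma toric_ideal_iff: "p \<in> toric_ideal V f \<longleftrightarrow> p \<in> polys V \<and> toric_map f p = 0"
  by (simp add: toric_ideal_def alg_hom_mon)

lemma binomial_in_toric_ideal:
  assumes "a \<in> monomials V" "b \<in> monomials V"
  shows "mon a - mon b \<in> toric_ideal V f \<longleftrightarrow> extend f a = extend f b"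
  using assms by (simp add: toric_ideal_iff polys_diff toric_map_diff)

text \<open>
  The terms of an element of the kernel must cancel within each fiber of the monomial map, so no
  term is alone in its fiber.
\<close>

lemma toric_ideal_fiber:
  assumes "p \<in> toric_ideal V f" "a \<in> Poly_Mapping.keys p"
  obtains b where "b \<in> Poly_Mapping.keys p" "b \<noteq> a" "extend f b = extend f a"
proof (rule ccontr)
  assume "\<not> thesis"
  with that have only: "\<And>b. b \<in> Poly_Mapping.keys p \<Longrightarrow> extend f b = extend f a \<Longrightarrow> b = a"
    by blast
  have "0 = Poly_Mapping.lookup (toric_map f p) (extend f a)"
    using assms(1) by (simp add: toric_ideal_iff)
  also have "\<dots> = (\<Sum>b\<in>Poly_Mapping.keys p. if b = a then Poly_Mapping.lookup p a else 0)"
    unfolding toric_map_def lookup_sum lookup_single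
    by (intro sum.cong refl) (auto simp: when_def dest: only)
  also have "\<dots> = Poly_Mapping.lookup p a"
    using assms(2) by simp
  finally show False
    using assms(2) by (simp add: in_keys_iff)
qed

subsection \<open>Reduction modulo a finite set\<close>

lemma normal_form_in_toric:
  assumes "(reduces lt G)\<^sup>*\<^sup>* p r" "G \<subseteq> toric_ideal V f" "p \<in> polys V"
    and lt: "\<And>g. g \<in> G \<Longrightarrow> init lt g \<in> Poly_Mapping.keys g"
  shows "r \<in> polys V \<and> p - r \<in> toric_ideal V f"
  using assms(1)
proof (induction rule: rtranclp_induct)
  case base
  then show ?case using assms(3) by (simp add: toric_ideal_iff)
next
  case (step q r)
  then obtain g c where g: "g \<in> G" "Poly_Mapping.lookup q (init lt g + c) \<noteq> 0"
    and r: "r = q - Poly_Mapping.single c (Poly_Mapping.lookup q (init lt g + c) / Poly_Mapping.lookup g (init lt g)) * g"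
      (is "r = q - Poly_Mapping.single c ?k * g")
    unfolding reduces_def by blast
  have "init lt g + c \<in> monomials V"
    using step.IH g(2) by (auto simp: in_keys_iff dest: polysD)
  then have "Poly_Mapping.single c ?k * g \<in> polys V" 
    using g(1) assms(2) by (auto simp: toric_ideal_iff intro!: polys_mult polys_single)
  moreover have "toric_map f (Poly_Mapping.single c ?k * g) = 0"
    using g(1) assms(2) by (auto simp: toric_map_single_mult toric_ideal_iff)
  ultimately show ?case
    using step.IH assms(3) unfolding r by (auto simp: toric_ideal_iff polys_diff toric_map_diff)
qed

text \<open>
  The division algorithm terminates by homogeneity: all terms stay in the finite set of monomials
  of one degree. Cancelling the
  greatest reducible term lowers the rank of the greatest reducible term in that set.
\<close>

lemma ex_normal_form:
  fixes G :: "('v, 'k::field) mpoly set"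
  assumes lt: "monomial_order V lt" and fin: "finite V"
    and G: "\<And>g. g \<in> G \<Longrightarrow> g \<in> polys V \<and> quadratic g"
    and p: "\<And>a. a \<in> Poly_Mapping.keys p \<Longrightarrow> a \<in> monomials V \<and> mdeg a = n"
  shows "\<exists>r. normal_form lt G p r"
proof -
  define D where "D = {a \<in> monomials V. mdeg a = n}"
  have finD: "finite D"
    unfolding D_def by (rule finite_monomials_of_degree[OF fin])
  define rank where "rank a = card {b \<in> D. lt b a}" for a
  have rank_less: "rank a < rank b" if "a \<in> D" "b \<in> D" "lt a b" for a b
    unfolding rank_def
  proof (rule psubset_card_mono)
    show "finite {c \<in> D. lt c b}" using finD by simp
    have "lt c b" if "c \<in> D" "lt c a" for c
      using monomial_orderD(2)[OF lt, of c a b] that \<open>a \<in> D\<close> \<open>b \<in> D\<close> \<open>lt a b\<close> by (auto simp: D_def)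
    moreover have "\<not> lt a a"
      using monomial_orderD(1)[OF lt, of a] \<open>a \<in> D\<close> by (auto simp: D_def)
    ultimately show "{c \<in> D. lt c a} \<subset> {c \<in> D. lt c b}"
      using that by blast
  qed
  have "\<exists>r. normal_form lt G p r"
    if "Poly_Mapping.keys p \<subseteq> D" "\<And>a. a \<in> Poly_Mapping.keys p \<Longrightarrow> \<not> standard lt G a \<Longrightarrow> rank a < k" for p k
    using that
  proof (induction k arbitrary: p)
    case 0
    then have "normal_form lt G p p"
      by (auto simp: normal_form_def)
    then show ?case by blast
  next
    case (Suc k)
    show ?case
    proof (cases "\<exists>a\<in>Poly_Mapping.keys p. \<not> standard lt G a \<and> rank a = k")
      case False
      with Suc.prems(2) have "rank a < k" if "a \<in> Poly_Mapping.keys p" "\<not> standard lt G a" for a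
        using that less_antisym by metis
      with Suc show ?thesis by blast
    next
      case True
      then obtain a where a: "a \<in> Poly_Mapping.keys p" "\<not> standard lt G a" "rank a = k" by blast
      then obtain g c where g: "g \<in> G" and c: "a = init lt g + c"
        by (auto simp: standard_def divides_def)
      have aD: "a \<in> D" using a Suc.prems by auto
      define q where "q = Poly_Mapping.single c (Poly_Mapping.lookup p (init lt g + c) / Poly_Mapping.lookup g (init lt g)) * g"
      have g0: "g \<in> polys V" "g \<noteq> 0" using G[OF g] by (auto simp: quadratic_def)
      note ini = init_greatest[OF lt g0]
      have c': "c \<in> monomials V" "mdeg c + 2 = n"
        using aD ini(1) G[OF g] by (auto simp: D_def c quadratic_def)
      have keys_q: "\<exists>b. x = c + b \<and> b \<in> Poly_Mapping.keys g" if "x \<in> Poly_Mapping.keys q" for x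
        using keys_mult[of "Poly_Mapping.single c (Poly_Mapping.lookup p (init lt g + c) / Poly_Mapping.lookup g (init lt g))" g] that
        unfolding q_def by (auto split: if_splits)
      have q: "x \<in> D \<and> (x \<noteq> a \<longrightarrow> lt x a)" if x: "x \<in> Poly_Mapping.keys q" for x
      proof -
        obtain b where b: "x = c + b" "b \<in> Poly_Mapping.keys g" using keys_q[OF x] by blast
        have bV: "b \<in> monomials V" "mdeg b = 2"
          using G[OF g] b(2) by (auto simp: quadratic_def dest: polysD)
        have "lt x a" if "x \<noteq> a"
        proof -
          have "b \<noteq> init lt g" using that by (auto simp: b(1) c add.commute)
          then have "lt b (init lt g)" by (rule ini(2)[OF b(2)])
          then show ?thesis
            using monomial_orderD(5)[OF lt bV(1) polysD[OF g0(1) ini(1)] c'(1)] unfolding b c by (simp add: add.commute)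
        qed
        with bV c' b show ?thesis by (auto simp: D_def)
      qed
      \<comment> \<open>The quotient of the coefficients in the division step makes the terms at \<open>a\<close> cancel.\<close>
      have qa: "Poly_Mapping.lookup q a = Poly_Mapping.lookup p a"
      proof -
        have "Poly_Mapping.lookup (Poly_Mapping.single c k * g) (init lt g + c) = k * Poly_Mapping.lookup g (init lt g)" for k
        proof -
          have "Poly_Mapping.single c k * g = (\<Sum>b\<in>Poly_Mapping.keys g. Poly_Mapping.single (c + b) (k * Poly_Mapping.lookup g b))"
            by (subst (1) poly_eq_sum_monomials[of g]) (simp add: sum_distrib_left mult_single)
          then have "Poly_Mapping.lookup (Poly_Mapping.single c k * g) (init lt g + c) =
              (\<Sum>b\<in>Poly_Mapping.keys g. if b = init lt g then k * Poly_Mapping.lookup g (init lt g) else 0)"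
            by (simp add: lookup_sum lookup_single when_def add.commute[of c] cong: if_cong)
          then show ?thesis using ini(1) by simp
        qed
        then show ?thesis
          using ini(1) unfolding q_def c by (simp add: in_keys_iff)
      qed
      have red: "reduces lt G p (p - q)"
        unfolding reduces_def q_def using g a(1) c by (auto simp: in_keys_iff)
      have "x \<in> D \<and> (\<not> standard lt G x \<longrightarrow> rank x < k)" if x: "x \<in> Poly_Mapping.keys (p - q)" for x
      proof -
        have "x \<noteq> a" using x qa by (auto simp: in_keys_iff lookup_minus)
        consider "x \<in> Poly_Mapping.keys q" | "x \<in> Poly_Mapping.keys p" "x \<notin> Poly_Mapping.keys q"
          using x keys_diff[of p q] by blast
        then show ?thesis
        proof cases
          case 1
          then show ?thesis using q[of x] rank_less[of x a] aD \<open>x \<noteq> a\<close> a(3) by auto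
        next
          case 2
          then have xD: "x \<in> D" using Suc.prems(1) by auto
          have "rank x \<noteq> k"
          proof
            assume "rank x = k"
            moreover have "lt x a \<or> lt a x"
              using monomial_orderD(3)[OF lt, of x a] xD aD \<open>x \<noteq> a\<close> by (auto simp: D_def)
            ultimately show False
              using rank_less[of x a] rank_less[of a x] xD aD a(3) by auto
          qed
          moreover have "rank x < Suc k" if "\<not> standard lt G x"
            using Suc.prems(2) 2 that by blast
          ultimately show ?thesis using xD by auto
        qed
      qed
      then obtain r where "normal_form lt G (p - q) r"
        using Suc.IH[of "p - q"] by blast
      with red have "normal_form lt G p r"
        unfolding normal_form_def by (meson converse_rtranclp_into_rtranclp)
      then show ?thesis by blast
    qed
  qed
  note main = this
  show ?thesis
  proof (rule main)
    show "Poly_Mapping.keys p \<subseteq> D" using p by (auto simp: D_def)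
    show "rank a < Suc (card D)" for a
      unfolding rank_def using card_mono[OF finD, of "{b \<in> D. lt b a}"] by auto
  qed
qed


subsection \<open>Initial ideals of toric ideals\<close>

text \<open>
  Configurations enter through a consequence of their grading vector: fibers are homogeneous, hence finite.
  The nested configuration inherits this property from the outer and the inner configurations by a
  count of degrees.
\<close>

locale toric_order =
  fixes V :: "'v set" and f :: "'v \<Rightarrow> 'w monomial" and lt :: "'v monomial \<Rightarrow> 'v monomial \<Rightarrow> bool"
  assumes finite_vars: "finite V" and order: "monomial_order V lt"
    and degree: "\<And>a b. a \<in> monomials V \<Longrightarrow> b \<in> monomials V \<Longrightarrow> extend f a = extend f b \<Longrightarrow> mdeg a = mdeg b"
begin

abbreviation same_fiber :: "'v monomial \<Rightarrow> 'v monomial \<Rightarrow> bool" where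
  "same_fiber a b \<equiv> a \<in> monomials V \<and> b \<in> monomials V \<and> extend f a = extend f b"

text \<open>
  Homogeneous fibers are finite, so a total order has a least element on each of them.
\<close>

lemma fiber_least:
  assumes "a \<in> monomials V"
  obtains b where "same_fiber b a" "\<And>c. same_fiber c a \<Longrightarrow> c \<noteq> b \<Longrightarrow> lt b c"
proof -
  let ?S = "{c. same_fiber c a}"
  have "?S \<subseteq> {c \<in> monomials V. mdeg c = mdeg a}"
    using degree by auto
  then have "finite ?S"
    using finite_monomials_of_degree[OF finite_vars] by (rule finite_subset)
  moreover have "?S \<noteq> {}" "?S \<subseteq> monomials V"
    using assms by auto
  ultimately show thesis
    using ex_least[OF order, of ?S] that by blast
qed

text \<open>
  The initial monomial of a kernel element shares its fiber with a smaller term of that element. So a monomial divisible by it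
  is not the least in its own fiber.
\<close>

lemma least_standard:
  fixes G :: "('v, 'k::field) mpoly set"
  assumes "G \<subseteq> toric_ideal V f - {0}" "b \<in> monomials V"
    and least: "\<And>c. same_fiber c b \<Longrightarrow> c \<noteq> b \<Longrightarrow> lt b c"
  shows "standard lt G b"
  unfolding standard_def
proof (intro ballI notI)
  fix g assume "g \<in> G" "divides (init lt g) b"
  then obtain c where b: "b = init lt g + c" by (auto simp: divides_def)
  have g: "g \<in> toric_ideal V f" "g \<in> polys V" "g \<noteq> 0"
    using \<open>g \<in> G\<close> assms(1) by (auto simp: toric_ideal_iff)
  note ini = init_greatest[OF order g(2,3)]
  obtain e where e: "e \<in> Poly_Mapping.keys g" "e \<noteq> init lt g" "extend f e = extend f (init lt g)"
    using toric_ideal_fiber[OF g(1) ini(1)] by blast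
  have V: "e \<in> monomials V" "init lt g \<in> monomials V" "c \<in> monomials V"
    using polysD[OF g(2)] e(1) ini(1) assms(2) b by auto
  have "lt (e + c) b"
    unfolding b by (rule monomial_orderD(5)[OF order V(1,2,3) ini(2)[OF e(1,2)]])
  moreover have "lt b (e + c)"
    using V e by (intro least) (auto simp: b)
  ultimately show False
    using monomial_order_asym[OF order, of "e + c" b] V assms(2) by simp
qed

text \<open>
  An initial monomial of the ideal is never the least of its fiber. If standard monomials
  are unique in their fibers, the least element is the only standard one, so every initial monomial
  is divisible by some \<open>init g\<close>.
\<close>

lemma groebner_basis_criterion:
  fixes G :: "('v, 'k::field) mpoly set"
  assumes "finite G" and sub: "G \<subseteq> toric_ideal V f - {0}"
    and unique: "\<And>a b. same_fiber a b \<Longrightarrow> standard lt G a \<Longrightarrow> standard lt G b \<Longrightarrow> a = b"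
  shows "groebner_basis V lt (toric_ideal V f) G"
proof -
  have "\<exists>g\<in>G. divides (init lt g) (init lt p)" if p: "p \<in> toric_ideal V f" "p \<noteq> 0"
    for p :: "('v, 'k) mpoly"
  proof (rule ccontr)
    assume "\<not> ?thesis"
    then have std: "standard lt G (init lt p)" by (auto simp: standard_def)
    have pV: "p \<in> polys V" using p by (simp add: toric_ideal_iff)
    note ini = init_greatest[OF order pV p(2)]
    obtain b where b: "b \<in> Poly_Mapping.keys p" "b \<noteq> init lt p" "extend f b = extend f (init lt p)"
      using toric_ideal_fiber[OF p(1) ini(1)] by blast
    have V: "init lt p \<in> monomials V" "b \<in> monomials V"
      using polysD[OF pV] b(1) ini(1) by auto
    obtain c where c: "same_fiber c (init lt p)" "\<And>e. same_fiber e (init lt p) \<Longrightarrow> e \<noteq> c \<Longrightarrow> lt c e"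
      using fiber_least[OF V(1)] by blast
    have "standard lt G c"
      using c by (intro least_standard[OF sub]) auto
    then have "c = init lt p" using unique c(1) std by blast
    then have "lt (init lt p) b" using c(2)[of b] b V by auto
    with ini(2)[OF b(1,2)] show False
      using monomial_order_asym[OF order V(1,2)] by blast
  qed
  note div = this
  have "initial_ideal V lt (toric_ideal V f :: ('v, 'k) mpoly set) \<subseteq> ideal_generated V ((\<lambda>g. mon (init lt g)) ` G)"
    unfolding initial_ideal_def
  proof (rule ideal_generated_subset)
    fix s :: "('v, 'k) mpoly"
    assume "s \<in> (\<lambda>p. mon (init lt p)) ` (toric_ideal V f - {0} :: ('v, 'k) mpoly set)"
    then obtain p :: "('v, 'k) mpoly" where p: "p \<in> toric_ideal V f" "p \<noteq> 0" and s: "s = mon (init lt p)"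
      by auto
    obtain g c where g: "g \<in> G" and c: "init lt p = init lt g + c"
      using div[OF p] by (auto simp: divides_def)
    have "init lt p \<in> monomials V"
      using p init_greatest(1)[OF order, of p] by (auto simp: toric_ideal_iff dest: polysD)
    then have "(mon c :: ('v, 'k) mpoly) \<in> polys V" by (simp add: c)
    moreover have "s = mon c * mon (init lt g)"
      by (simp add: s c mon_add mult.commute)
    ultimately show "\<exists>x\<in>polys V. \<exists>t\<in>(\<lambda>g. mon (init lt g)) ` G. s = x * t"
      using g by blast
  qed
  moreover have "ideal_generated V ((\<lambda>g. mon (init lt g)) ` G) \<subseteq> initial_ideal V lt (toric_ideal V f :: ('v, 'k) mpoly set)"
    unfolding initial_ideal_def using sub by (intro ideal_generated_mono) blast
  ultimately show ?thesis
    using assms(1) sub by (auto simp: groebner_basis_def)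
qed

end

locale toric_groebner = toric_order V f lt
  for V :: "'v set" and f :: "'v \<Rightarrow> 'w monomial" and lt :: "'v monomial \<Rightarrow> 'v monomial \<Rightarrow> bool" +
  fixes G :: "('v, 'k::field) mpoly set"
  assumes groebner: "groebner_basis V lt (toric_ideal V f) G"
    and quadratic_G: "\<And>g. g \<in> G \<Longrightarrow> quadratic g"
begin

lemma G_toric: "G \<subseteq> toric_ideal V f - {0}"
  using groebner by (simp add: groebner_basis_def)

lemma G_init:
  assumes "g \<in> G"
  shows "init lt g \<in> Poly_Mapping.keys g" "mdeg (init lt g) = 2"
proof -
  have g: "g \<in> polys V" "g \<noteq> 0"
    using assms G_toric by (auto simp: toric_ideal_iff)
  then show "init lt g \<in> Poly_Mapping.keys g"
    by (rule init_greatest(1)[OF order])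
  then show "mdeg (init lt g) = 2"
    using quadratic_G[OF assms] by (auto simp: quadratic_def)
qed

text \<open>
  The initial monomial of a nonzero element of the ideal is divisible by some \<open>init g\<close>.
\<close>

lemma standard_zero:
  fixes p :: "('v, 'k) mpoly"
  assumes "p \<in> toric_ideal V f" "\<And>a. a \<in> Poly_Mapping.keys p \<Longrightarrow> standard lt G a"
  shows "p = 0"
proof (rule ccontr)
  assume "p \<noteq> 0"
  then have "(mon (init lt p) :: ('v, 'k) mpoly) \<in> initial_ideal V lt (toric_ideal V f)"
    unfolding initial_ideal_def using assms(1) \<open>p \<noteq> 0\<close>
    by (intro generator_in_ideal_generated imageI) simp
  then have "(mon (init lt p) :: ('v, 'k) mpoly) \<in> ideal_generated V (mon ` init lt ` G)"
    using groebner by (simp add: groebner_basis_def image_image)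
  then obtain g where "g \<in> G" "divides (init lt g) (init lt p)"
    using monomial_ideal_divides by blast
  moreover have "init lt p \<in> Poly_Mapping.keys p"
    using assms(1) \<open>p \<noteq> 0\<close> by (intro init_greatest(1)[OF order]) (auto simp: toric_ideal_iff)
  ultimately show False
    using assms(2) by (auto simp: standard_def)
qed

lemma standard_unique:
  assumes "same_fiber a b" "standard lt G a" "standard lt G b"
  shows "a = b"
proof -
  have "(mon a - mon b :: ('v, 'k) mpoly) = 0"
  proof (rule standard_zero)
    show "mon a - mon b \<in> toric_ideal V f"
      using assms(1) by (simp add: binomial_in_toric_ideal)
    show "standard lt G c" if "c \<in> Poly_Mapping.keys (mon a - mon b :: ('v, 'k) mpoly)" for c
      using that keys_diff[of "mon a :: ('v, 'k) mpoly" "mon b"] assms(2,3) by auto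
  qed
  then show ?thesis by simp
qed

lemma standard_least:
  assumes "same_fiber a b" "standard lt G b" "a \<noteq> b"
  shows "lt b a"
proof -
  obtain c where c: "same_fiber c a" "\<And>e. same_fiber e a \<Longrightarrow> e \<noteq> c \<Longrightarrow> lt c e"
    using fiber_least assms(1) by blast
  then have "standard lt G c"
    by (intro least_standard[OF G_toric]) auto
  then have "c = b" using standard_unique c(1) assms(1,2) by auto
  then show ?thesis using c(2)[of a] assms by auto
qed

lemma ex_standard:
  assumes "a \<in> monomials V"
  obtains b where "same_fiber b a" "standard lt G b"
proof -
  obtain b where b: "same_fiber b a" "\<And>c. same_fiber c a \<Longrightarrow> c \<noteq> b \<Longrightarrow> lt b c"
    using fiber_least[OF assms] by blast
  then have "standard lt G b"
    by (intro least_standard[OF G_toric]) auto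
  with b(1) show thesis by (rule that)
qed

text \<open>
  For a monomial, the normal form is the standard monomial of its fiber, even if the
  elements of the basis are not binomials. Through this lemma the relation \<^const>\<open>normal_form\<close> turns into a
  statement about fibers and standard monomials.
\<close>

lemma normal_form_mon_iff:
  assumes "a \<in> monomials V" "b \<in> monomials V"
  shows "normal_form lt G (mon a) (mon b) \<longleftrightarrow> standard lt G b \<and> extend f a = extend f b"
proof -
  have polys: "(mon a :: ('v, 'k) mpoly) \<in> polys V" using assms by simp
  have G_sub: "G \<subseteq> toric_ideal V f" using G_toric by blast
  show ?thesis
  proof safe
    assume nf: "normal_form lt G (mon a) (mon b)"
    then show "standard lt G b" by (simp add: normal_form_def)
    have "(mon a - mon b :: ('v, 'k) mpoly) \<in> toric_ideal V f"
      using normal_form_in_toric[OF _ G_sub polys G_init(1)] nf by (auto simp: normal_form_def)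
    then show "extend f a = extend f b"
      using assms by (simp add: binomial_in_toric_ideal)
  next
    assume b: "standard lt G b" "extend f a = extend f b"
    have "g \<in> polys V \<and> quadratic g" if "g \<in> G" for g
      using that G_sub quadratic_G by (auto simp: toric_ideal_iff)
    then obtain r where r: "normal_form lt G (mon a) r"
      using ex_normal_form[OF order finite_vars, of G "mon a" "mdeg a"] assms(1) by auto
    then have rV: "r \<in> polys V" "mon a - r \<in> toric_ideal V f"
      using normal_form_in_toric[OF _ G_sub polys G_init(1)] by (auto simp: normal_form_def)
    have "mon b - r = 0"
    proof (rule standard_zero)
      show "mon b - r \<in> toric_ideal V f"
        using rV assms b(2) by (auto simp: toric_ideal_iff polys_diff toric_map_diff)
      show "standard lt G c" if "c \<in> Poly_Mapping.keys (mon b - r)" for c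
        using that keys_diff[of "mon b" r] b(1) r by (auto simp: normal_form_def)
    qed
    with r show "normal_form lt G (mon a) (mon b)" by simp
  qed
qed

end

section \<open>Combinatorics of expressions\<close>

text \<open>
  Equal images under \<^const>\<open>fst\<close> match the elements of \<open>P\<close> with those of \<open>Q\<close>, and each match increases the
  second component.
\<close>

lemma multiset_pairs_less:
  fixes P Q :: "(nat \<times> nat) multiset"
  assumes "image_mset fst P = image_mset fst Q" "P \<noteq> {#}"
    and "\<And>i j l. (i, j) \<in># P \<Longrightarrow> (i, l) \<in># Q \<Longrightarrow> j < l"
  shows "sum_mset (image_mset snd P) < sum_mset (image_mset snd Q)"
  using assms
proof (induction P arbitrary: Q)
  case (add p P)
  obtain q where q: "q \<in># Q" "fst q = fst p"
    using add.prems(1) by (metis imageE set_image_mset union_single_eq_member image_mset_add_mset)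
  then obtain Q' where Q: "Q = add_mset q Q'"
    by (metis multi_member_split)
  have less: "snd p < snd q"
    using add.prems(3)[of "fst p" "snd p" "snd q"] q by (metis prod.collapse union_single_eq_member)
  have img: "image_mset fst P = image_mset fst Q'"
    using add.prems(1) q by (simp add: Q)
  show ?case
  proof (cases "P = {#}")
    case True
    with img have "Q' = {#}" by simp
    with True less show ?thesis by (simp add: Q)
  next
    case False
    then have "sum_mset (image_mset snd P) < sum_mset (image_mset snd Q')"
      using add.prems(3) by (intro add.IH[OF img]) (auto simp: Q)
    with less show ?thesis by (simp add: Q)
  qed
qed simp

text \<open>
  An aligned \<open>Z\<close> contains the smallest available elements with the prescribed first components, so it has
  the least sum among all parts of \<open>Z + R\<close> of the same shape and is the only one with this sum. After
  removing what \<open>Z\<close> and \<open>Z'\<close> have in common, the rest of \<open>Z'\<close> is taken from \<open>R\<close>, and the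
  rest of \<open>Z\<close> lies strictly below it.
\<close>

lemma aligned_minimal:
  fixes Z R Z' R' :: "(nat \<times> nat) multiset"
  assumes eq: "Z + R = Z' + R'" and shape: "image_mset fst Z = image_mset fst Z'"
    and aligned: "\<forall>i j l. (i, j) \<in># Z \<longrightarrow> (i, l) \<in># R \<longrightarrow> j \<le> l"
  shows "sum_mset (image_mset snd Z) \<le> sum_mset (image_mset snd Z')"
    and "sum_mset (image_mset snd Z) = sum_mset (image_mset snd Z') \<Longrightarrow> Z = Z'"
proof -
  define C where "C = Z \<inter># Z'"
  define P where "P = Z - C"
  define Q where "Q = Z' - C"
  have Z: "Z = C + P" "Z' = C + Q"
    by (auto simp: C_def P_def Q_def intro!: multiset_eqI)
  have disj: "P \<inter># Q = {#}"
    by (rule multiset_eqI) (auto simp: P_def Q_def C_def)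
  have "P + R = Q + R'"
    using eq unfolding Z by simp
  have QR: "q \<in># R" if "q \<in># Q" for q
  proof -
    have "q \<notin># P" using disj that by (metis disjunct_not_in)
    moreover have "q \<in># P + R" using that \<open>P + R = Q + R'\<close> by simp
    ultimately show ?thesis by simp
  qed
  have less: "j < l" if "(i, j) \<in># P" "(i, l) \<in># Q" for i j l
  proof -
    have "(i, j) \<in># Z" "(i, l) \<in># R" using QR that by (simp_all add: Z)
    then have "j \<le> l" using aligned by blast
    moreover have "j \<noteq> l" using that disj by (metis disjunct_not_in)
    ultimately show ?thesis by simp
  qed
  have img: "image_mset fst P = image_mset fst Q"
    using shape unfolding Z by simp
  have "sum_mset (image_mset snd P) < sum_mset (image_mset snd Q)" if "P \<noteq> {#}"
    using img that less by (rule multiset_pairs_less)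
  moreover have "Q = {#}" if "P = {#}" using img that by simp
  ultimately show "sum_mset (image_mset snd Z) \<le> sum_mset (image_mset snd Z')"
    and "sum_mset (image_mset snd Z) = sum_mset (image_mset snd Z') \<Longrightarrow> Z = Z'"
    unfolding Z by (cases "P = {#}"; simp)+
qed

subsection \<open>Lists as expressions\<close>

lemma tmon_simps [simp]: "tmon [] = 0" "tmon (i # is) = var i + tmon is"
  by (simp_all add: tmon_def)

lemma lookup_tmon: "Poly_Mapping.lookup (tmon is) i = count (mset is) i"
  by (induction "is") (auto simp: lookup_add lookup_single when_def)

lemma tmon_eq_iff: "tmon is = tmon js \<longleftrightarrow> mset is = mset js"
  by (auto simp: poly_mapping_eq_iff lookup_tmon multiset_eq_iff fun_eq_iff)

lemma zpart_simps [simp]: "zpart i [] = 0"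
  "zpart i ((k, j) # es) = (if k = i then var j else 0) + zpart i es"
  by (simp_all add: zpart_def)

lemma zpart_append [simp]: "zpart i (es @ fs) = zpart i es + zpart i fs"
  by (simp add: zpart_def)

lemma lookup_zpart: "Poly_Mapping.lookup (zpart i es) j = count (mset es) (i, j)"
  by (induction es) (auto simp: lookup_add lookup_single when_def split: if_splits)

lemma zpart_cong: "mset es = mset fs \<Longrightarrow> zpart i es = zpart i fs"
  by (intro poly_mapping_eqI) (simp add: lookup_zpart)

lemma mset_eq_zpartI: "(\<And>i. zpart i es = zpart i fs) \<Longrightarrow> mset es = mset fs"
  by (intro multiset_eqI) (metis lookup_zpart surj_pair)

lemma zpart_eq_0: "i \<notin> fst ` set es \<Longrightarrow> zpart i es = 0"
  by (induction es) auto

lemma mdeg_zpart: "mdeg (zpart i es) = Poly_Mapping.lookup (tmon (map fst es)) i"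
  by (induction es) (auto simp: lookup_add lookup_single when_def)

lemma zpart_monomials: "(\<And>j. (i, j) \<in> set es \<Longrightarrow> j \<in> L) \<Longrightarrow> zpart i es \<in> monomials L"
  by (induction es) auto

lemma ex_single_list:
  assumes "b \<in> monomials L"
  obtains js where "set js \<subseteq> L" "zpart i (map (Pair i) js) = b"
  using assms
proof (induction arbitrary: thesis rule: monomial_induct)
  case zero
  then show ?case by (metis empty_iff list.set(1) list.simps(8) subsetI zpart_simps(1))
next
  case (var j b)
  obtain js where "set js \<subseteq> L" "zpart i (map (Pair i) js) = b"
    using var.IH by blast
  with var.hyps show ?case by (intro var.prems[of "j # js"]) auto
qed

text \<open>
  The monomials \<open>zpart i es\<close> can be prescribed independently of each other; this is how standard
  expressions are built from standard monomials.
\<close>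

lemma ex_expression_list:
  assumes "finite S" "\<And>i. i \<in> S \<Longrightarrow> b i \<in> monomials (L i)"
  obtains es where "\<And>i j. (i, j) \<in> set es \<Longrightarrow> i \<in> S \<and> j \<in> L i" "\<And>i. i \<in> S \<Longrightarrow> zpart i es = b i"
  using assms
proof (induction arbitrary: thesis rule: finite_induct)
  case empty
  show ?case by (rule empty(1)[of "[]"]) auto
next
  case (insert k S)
  obtain es where es: "\<And>i j. (i, j) \<in> set es \<Longrightarrow> i \<in> S \<and> j \<in> L i" "\<And>i. i \<in> S \<Longrightarrow> zpart i es = b i"
    using insert.IH insert.prems(2) by blast
  obtain js where js: "set js \<subseteq> L k" "zpart k (map (Pair k) js) = b k"
    using ex_single_list[of "b k" "L k" k] insert.prems(2) by blast
  show ?case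
  proof (rule insert.prems(1)[of "map (Pair k) js @ es"])
    show "i \<in> insert k S \<and> j \<in> L i" if "(i, j) \<in> set (map (Pair k) js @ es)" for i j
      using that js(1) es(1) by auto
    have "zpart k es = 0"
      using es(1) insert.hyps by (intro zpart_eq_0) auto
    moreover have "zpart i (map (Pair k) js) = 0" if "i \<in> S" for i
      using that insert.hyps by (intro zpart_eq_0) auto
    ultimately show "zpart i (map (Pair k) js @ es) = b i" if "i \<in> insert k S" for i
      using that js(2) es(2) by auto
  qed
qed

lemma sorted_by_fst:
  obtains fs :: "(nat \<times> nat) list" where "mset fs = mset es" "sorted (map fst fs)"
  using sorted_sort_key[of fst es] mset_sort[of fst es] by metis

lemma aligned_iff: "aligned es fs \<longleftrightarrow> (\<forall>i j l. (i, j) \<in># mset es \<longrightarrow> (i, l) \<in># mset fs \<longrightarrow> j \<le> l)"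
  by (auto simp: aligned_def)

section \<open>Normal forms of products\<close>

lemma var_divides_extend:
  assumes "u \<in> monomials N" "divides (var a) (extend h u)"
  obtains M u' c where "u = var M + u'" "h M = var a + c"
proof -
  have "a \<in> Poly_Mapping.keys (extend h u)"
    using assms(2) by (auto simp: divides_def in_keys_iff lookup_add)
  with assms(1) have "\<exists>M u' c. u = var M + u' \<and> h M = var a + c"
  proof (induction rule: monomial_induct)
    case (var M u)
    show ?case
    proof (cases "a \<in> Poly_Mapping.keys (h M)")
      case True
      then obtain c where "h M = var a + c" by (rule split_var)
      then show ?thesis by blast
    next
      case False
      then have "a \<in> Poly_Mapping.keys (extend h u)"
        using var.prems by (simp add: in_keys_iff lookup_add)
      then obtain M' u' c where "u = var M' + u'" "h M' = var a + c" using var.IH by blast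
      then have "var M + u = var M' + (var M + u')" by (simp add: ac_simps)
      with \<open>h M' = var a + c\<close> show ?thesis by blast
    qed
  qed simp
  then show thesis using that by blast
qed

lemma standard_divides: "standard lt G b \<Longrightarrow> divides a b \<Longrightarrow> standard lt G a"
  unfolding standard_def divides_def by (metis add.assoc)

text \<open>
  A divisor of degree two of a product of monomials \<open>h M\<close> divides one of the factors or the
  product of two of them. So for a quadratic Groebner basis, standardness is tested on
  pairs of variables.
\<close>

lemma (in toric_groebner) standard_extendI:
  assumes u: "u \<in> monomials N"
    and single: "\<And>M. M \<in> N \<Longrightarrow> standard lt G (h M)"
    and pair: "\<And>M M' u'. u = var M + var M' + u' \<Longrightarrow> standard lt G (h M + h M')"
  shows "standard lt G (extend h u)"
  unfolding standard_def
proof (intro ballI notI)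
  fix g assume g: "g \<in> G" "divides (init lt g) (extend h u)"
  obtain a b where ab: "init lt g = var a + var b"
    using G_init(2)[OF g(1)] by (rule mdeg_two)
  have "divides (var a) (extend h u)"
    using g(2) unfolding ab divides_def by (metis add.assoc)
  then obtain M u' c where M: "u = var M + u'" "h M = var a + c"
    by (rule var_divides_extend[OF u])
  obtain r where "var a + c + extend h u' = var a + var b + r"
    using g(2) by (auto simp: ab M divides_def)
  then have r: "c + extend h u' = var b + r"
    by (simp add: add.assoc)
  have "b \<in> Poly_Mapping.keys (c + extend h u')"
    unfolding r by (simp add: in_keys_iff lookup_add)
  then consider "b \<in> Poly_Mapping.keys c" | "b \<in> Poly_Mapping.keys (extend h u')"
    using keys_add[of c "extend h u'"] by blast
  then show False
  proof cases
    case 1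
    then obtain c' where "c = var b + c'" by (rule split_var)
    then have "divides (init lt g) (h M)"
      by (auto simp: M ab divides_def add.assoc)
    moreover have "M \<in> N" using u M by simp
    ultimately show False using single[of M] g(1) by (auto simp: standard_def)
  next
    case 2
    then obtain e where "extend h u' = var b + e" by (rule split_var)
    then have "divides (var b) (extend h u')" by (auto simp: divides_def)
    moreover have "u' \<in> monomials N" using u M by simp
    ultimately obtain M' u'' e where M': "u' = var M' + u''" "h M' = var b + e"
      by (metis var_divides_extend)
    have "divides (init lt g) (h M + h M')"
      unfolding divides_def ab M M' by (rule exI[of _ "c + e"]) (simp add: ac_simps)
    moreover have "standard lt G (h M + h M')"
      by (rule pair[of M M' u'']) (simp add: M M' ac_simps)
    ultimately show False using g(1) by (auto simp: standard_def)
  qed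
qed

text \<open>
  A grading vector computes the degree of a monomial from its image under \<open>f\<close>.
\<close>

lemma configuration_degree:
  fixes f :: "'v \<Rightarrow> 'w monomial"
  assumes "configuration W A" "f ` V \<subseteq> A" "a \<in> monomials V" "b \<in> monomials V" "extend f a = extend f b"
  shows "mdeg a = mdeg b"
proof -
  obtain w :: "'w \<Rightarrow> real" where w: "\<And>v. v \<in> V \<Longrightarrow> (\<Sum>x\<in>W. w x * real (Poly_Mapping.lookup (f v) x)) = 1"
    using assms(1,2) unfolding configuration_def by (meson image_subset_iff)
  define g where "g t = (\<Sum>x\<in>W. w x * real (Poly_Mapping.lookup t x))" for t
  have g: "g 0 = 0" "g (s + t) = g s + g t" for s t
    by (simp_all add: g_def lookup_add distrib_left sum.distrib)
  have "g (extend f c) = real (mdeg c)" if "c \<in> monomials V" for c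
    using that by (induction rule: monomial_induct) (simp_all add: g w[folded g_def])
  with assms(3-5) show ?thesis by (metis of_nat_eq_iff)
qed

lemma zero_not_in_configuration: "configuration W A \<Longrightarrow> 0 \<notin> A"
  by (auto simp: configuration_def)

section \<open>Standard expressions\<close>

locale nested_configuration =
  fixes d :: nat
    and A :: "nat monomial set"
    and mu lam :: "nat \<Rightarrow> nat"
    and m :: "nat \<Rightarrow> nat \<Rightarrow> (nat \<times> nat) monomial"
    and lt0 :: "nat list monomial \<Rightarrow> nat list monomial \<Rightarrow> bool"
    and lt :: "nat \<Rightarrow> nat monomial \<Rightarrow> nat monomial \<Rightarrow> bool"
    and G0 :: "(nat list, 'k::field) mpoly set"
    and G :: "nat \<Rightarrow> (nat, 'k) mpoly set"
  assumes config_A: "configuration {1..d} A"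
    and config_B: "\<And>i. i \<in> {1..d} \<Longrightarrow> configuration ({i} \<times> {1..mu i}) (m i ` {1..lam i})"
    and order_A: "monomial_order (yvars d A) lt0"
    and groebner_A: "groebner_basis (yvars d A) lt0 (toric_ideal (yvars d A) tmon) G0"
    and quadratic_A: "\<And>g. g \<in> G0 \<Longrightarrow> quadratic g"
    and order_B: "\<And>i. i \<in> {1..d} \<Longrightarrow> monomial_order {1..lam i} (lt i)"
    and groebner_B: "\<And>i. i \<in> {1..d} \<Longrightarrow> groebner_basis {1..lam i} (lt i) (toric_ideal {1..lam i} (m i)) (G i)"
    and quadratic_B: "\<And>i g. i \<in> {1..d} \<Longrightarrow> g \<in> G i \<Longrightarrow> quadratic g"
begin

abbreviation "N \<equiv> nested d A lam m"
abbreviation "se \<equiv> std_expr d A lam m lt G"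
abbreviation "shape M \<equiv> map fst (se M)"

lemma tmon_inj: "inj_on tmon (yvars d A)"
proof (rule inj_onI)
  fix "is" js assume "is \<in> yvars d A" "js \<in> yvars d A" "tmon is = tmon js"
  then have "mset is = mset js" "sorted is" "sorted js"
    by (simp_all add: yvars_def tmon_eq_iff)
  then show "is = js" by (metis properties_for_sort)
qed

sublocale y: toric_groebner "yvars d A" tmon lt0 G0
proof
  have sub: "tmon ` yvars d A \<subseteq> A" by (auto simp: yvars_def)
  moreover have "finite A" using config_A by (simp add: configuration_def)
  ultimately show "finite (yvars d A)"
    using tmon_inj by (meson finite_imageD finite_subset)
  show "mdeg a = mdeg b" if "a \<in> monomials (yvars d A)" "b \<in> monomials (yvars d A)" "extend tmon a = extend tmon b" for a b
    using configuration_degree[OF config_A sub that] .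
qed (use order_A groebner_A quadratic_A in auto)

lemma toric_groebner_B: "i \<in> {1..d} \<Longrightarrow> toric_groebner {1..lam i} (m i) (lt i) (G i)"
proof
  assume i: "i \<in> {1..d}"
  show "mdeg a = mdeg b" if "a \<in> monomials {1..lam i}" "b \<in> monomials {1..lam i}" "extend (m i) a = extend (m i) b" for a b
    using configuration_degree[OF config_B[OF i] subset_refl that] .
qed (use order_B groebner_B quadratic_B in auto)

definition factors_ok :: "(nat \<times> nat) list \<Rightarrow> bool" where
  "factors_ok es \<longleftrightarrow> (\<forall>i j. (i, j) \<in> set es \<longrightarrow> i \<in> {1..d} \<and> j \<in> {1..lam i})"

definition product :: "(nat \<times> nat) list \<Rightarrow> (nat \<times> nat) monomial" where
  "product es = (\<Sum>(i, j)\<leftarrow>es. m i j)"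

lemma expression_iff:
  "expression d A lam m es M \<longleftrightarrow> es \<noteq> [] \<and> factors_ok es \<and> tmon (map fst es) \<in> A \<and> M = product es"
  by (auto simp: expression_def factors_ok_def product_def)

lemma product_simps [simp]: "product [] = 0" "product ((i, j) # es) = m i j + product es"
  by (simp_all add: product_def)

lemma factors_ok_Cons [simp]: "factors_ok ((i, j) # es) \<longleftrightarrow> i \<in> {1..d} \<and> j \<in> {1..lam i} \<and> factors_ok es"
  by (auto simp: factors_ok_def)

lemma product_cong: "mset es = mset fs \<Longrightarrow> product es = product fs"
  unfolding product_def by (metis mset_map sum_mset_sum_list)

lemma factors_ok_cong: "mset es = mset fs \<Longrightarrow> factors_ok es \<longleftrightarrow> factors_ok fs"
  unfolding factors_ok_def by (metis set_mset_mset)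

lemma zpart_factors: "factors_ok es \<Longrightarrow> zpart i es \<in> monomials {1..lam i}"
  by (intro zpart_monomials) (auto simp: factors_ok_def)

lemma zpart_outside: "factors_ok es \<Longrightarrow> i \<notin> {1..d} \<Longrightarrow> zpart i es = 0"
  by (intro zpart_eq_0) (auto simp: factors_ok_def)

lemma lookup_other_block:
  assumes "k \<in> {1..d}" "a \<in> monomials {1..lam k}" "i \<noteq> k"
  shows "Poly_Mapping.lookup (extend (m k) a) (i, l) = 0"
proof -
  have "m k ` {1..lam k} \<subseteq> monomials ({k} \<times> {1..mu k})"
    using config_B[OF assms(1)] by (simp add: configuration_def)
  then have "extend (m k) a \<in> monomials ({k} \<times> {1..mu k})"
    using assms(2) by (intro extend_monomials) auto
  then have "(i, l) \<notin> Poly_Mapping.keys (extend (m k) a)"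
    using assms(3) by (auto simp: monomials_def)
  then show ?thesis by (simp add: in_keys_iff)
qed

text \<open>
  The variables of different inner rings are distinct, so the part of a product that lies in the
  \<open>i\<close>-th ring is the image of the \<open>i\<close>-th part of the expression.
\<close>

lemma lookup_product:
  assumes "factors_ok es"
  shows "Poly_Mapping.lookup (product es) (i, l) =
    (if i \<in> {1..d} then Poly_Mapping.lookup (extend (m i) (zpart i es)) (i, l) else 0)"
  using assms
proof (induction es)
  case (Cons e es)
  obtain k j where e: "e = (k, j)" by force
  with Cons.prems have "k \<in> {1..d}" "j \<in> {1..lam k}" "factors_ok es" by auto
  then have "Poly_Mapping.lookup (m k j) (i, l) = 0" if "i \<noteq> k"
    using lookup_other_block[of k "var j" i l] that by simp
  with Cons.IH[OF \<open>factors_ok es\<close>] \<open>k \<in> {1..d}\<close> show ?case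
    by (auto simp: e lookup_add)
qed simp

lemma mset_eq_if_zparts:
  assumes "factors_ok es" "factors_ok fs" "\<And>i. i \<in> {1..d} \<Longrightarrow> zpart i es = zpart i fs"
  shows "mset es = mset fs"
  by (rule mset_eq_zpartI) (metis assms zpart_outside)

lemma tmon_eq_if_degrees:
  assumes "factors_ok es" "factors_ok fs" "\<And>i. i \<in> {1..d} \<Longrightarrow> mdeg (zpart i es) = mdeg (zpart i fs)"
  shows "tmon (map fst es) = tmon (map fst fs)"
  by (rule poly_mapping_eqI) (metis mdeg_zpart assms zpart_outside)

lemma expression_factors: "expression d A lam m es M \<Longrightarrow> factors_ok es"
  by (simp add: expression_iff)

text \<open>
  Replacing each part of any expression of \<open>M\<close> by the standard monomial in its fiber changes neither the
  product nor, by homogeneity, the exponents of the outer monomial.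
\<close>

lemma ex_standard_expression:
  assumes "M \<in> N"
  obtains es where "standard_expression d A lam m lt G es M" "sorted (map fst es)"
proof -
  obtain es where es: "expression d A lam m es M"
    using assms by (auto simp: nested_def)
  note ok = expression_factors[OF es]
  have "\<exists>b. toric_order.same_fiber {1..lam i} (m i) b (zpart i es) \<and> standard (lt i) (G i) b" if "i \<in> {1..d}" for i
  proof -
    interpret toric_groebner "{1..lam i}" "m i" "lt i" "G i"
      using that by (rule toric_groebner_B)
    show ?thesis using ex_standard zpart_factors[OF ok] by metis
  qed
  then obtain b where b: "\<And>i. i \<in> {1..d} \<Longrightarrow> b i \<in> monomials {1..lam i} \<and>
      extend (m i) (b i) = extend (m i) (zpart i es) \<and> standard (lt i) (G i) (b i)"
    by metis
  obtain fs where fs: "\<And>i j. (i, j) \<in> set fs \<Longrightarrow> i \<in> {1..d} \<and> j \<in> {1..lam i}"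
      "\<And>i. i \<in> {1..d} \<Longrightarrow> zpart i fs = b i"
    using ex_expression_list[of "{1..d}" b "\<lambda>i. {1..lam i}"] b by auto
  obtain gs where gs: "mset gs = mset fs" "sorted (map fst gs)"
    by (rule sorted_by_fst)
  then have zgs: "zpart i gs = b i" if "i \<in> {1..d}" for i
    using fs(2)[OF that] zpart_cong by metis
  have ok': "factors_ok gs"
    using fs(1) factors_ok_cong[OF gs(1)] by (simp add: factors_ok_def)
  have "mdeg (b i) = mdeg (zpart i es)" if "i \<in> {1..d}" for i
  proof -
    interpret toric_groebner "{1..lam i}" "m i" "lt i" "G i"
      using that by (rule toric_groebner_B)
    show ?thesis using b[OF that] zpart_factors[OF ok] by (intro degree) auto
  qed
  then have tmon: "tmon (map fst gs) = tmon (map fst es)"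
    by (intro tmon_eq_if_degrees ok ok') (simp add: zgs)
  have "product gs = product es"
  proof (rule poly_mapping_eqI)
    fix x
    show "Poly_Mapping.lookup (product gs) x = Poly_Mapping.lookup (product es) x"
      using b by (cases x) (auto simp: lookup_product ok ok' zgs)
  qed
  moreover have "gs \<noteq> []"
    using tmon es zero_not_in_configuration[OF config_A] by (auto simp: expression_iff)
  ultimately have "expression d A lam m gs M"
    using es tmon ok' by (simp add: expression_iff)
  then have "standard_expression d A lam m lt G gs M"
    using b zgs by (simp add: standard_expression_def)
  then show thesis using gs(2) by (rule that)
qed

lemma se:
  assumes "M \<in> N"
  shows "standard_expression d A lam m lt G (se M) M" "sorted (shape M)"
proof -
  have "standard_expression d A lam m lt G (se M) M \<and> sorted (shape M)"
    unfolding std_expr_def by (rule someI_ex) (use ex_standard_expression[OF assms] in blast)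
  then show "standard_expression d A lam m lt G (se M) M" "sorted (shape M)" by auto
qed

lemma se_expression: "M \<in> N \<Longrightarrow> expression d A lam m (se M) M"
  using se(1) by (simp add: standard_expression_def)

lemma se_factors: "M \<in> N \<Longrightarrow> factors_ok (se M)"
  using se_expression expression_factors by blast

lemma se_product: "M \<in> N \<Longrightarrow> product (se M) = M"
  using se_expression by (auto simp: expression_iff)

lemma se_inject: "M \<in> N \<Longrightarrow> M' \<in> N \<Longrightarrow> mset (se M) = mset (se M') \<Longrightarrow> M = M'"
  by (metis se_product product_cong)

lemma zpart_se: "M \<in> N \<Longrightarrow> zpart i (se M) \<in> monomials {1..lam i}"
  using se_factors zpart_factors by blast

lemma zpart_se_standard: "M \<in> N \<Longrightarrow> i \<in> {1..d} \<Longrightarrow> standard (lt i) (G i) (zpart i (se M))"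
  using se(1) by (auto simp: standard_expression_def)

lemma shape_yvars: "M \<in> N \<Longrightarrow> shape M \<in> yvars d A"
  using se(2) se_expression[of M] by (auto simp: yvars_def expression_iff factors_ok_def)

lemma tmon_shape: "M \<in> N \<Longrightarrow> tmon (shape M) \<in> A"
  using shape_yvars by (auto simp: yvars_def)

lemma finite_N: "finite N"
proof -
  have "finite A" using config_A by (simp add: configuration_def)
  define n where "n = Max (insert 0 (mdeg ` A))"
  define P where "P = (\<Union>i\<in>{1..d}. {i} \<times> {1..lam i})"
  have "N \<subseteq> product ` {es. set es \<subseteq> P \<and> length es \<le> n}"
  proof
    fix M assume "M \<in> N"
    then obtain es where es: "expression d A lam m es M" by (auto simp: nested_def)
    have len: "length is = mdeg (tmon is)" for "is" by (induction "is") simp_all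
    have "mdeg (tmon (map fst es)) \<le> n"
      unfolding n_def using es \<open>finite A\<close> by (intro Max_ge) (auto simp: expression_iff)
    then have "length es \<le> n" using len[of "map fst es"] by simp
    moreover have "set es \<subseteq> P"
      using expression_factors[OF es] by (auto simp: factors_ok_def P_def)
    ultimately show "M \<in> product ` {es. set es \<subseteq> P \<and> length es \<le> n}"
      using es unfolding expression_iff by blast
  qed
  moreover have "finite P" by (auto simp: P_def)
  then have "finite (product ` {es. set es \<subseteq> P \<and> length es \<le> n})"
    by (intro finite_imageI finite_lists_length_le)
  ultimately show ?thesis by (rule finite_subset)
qed

section \<open>The fibers of the nested configuration\<close>

text \<open>
  \<open>Y u\<close> and \<open>Z i u\<close> are the exponents of \<open>\<phi>\<^sub>0 u\<close> and \<open>\<phi>\<^sub>i u\<close>. The multiset \<open>E u\<close> of all pairs \<open>(i, j)\<close> carries the same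
  information as the family of the \<open>Z i u\<close> and suits arguments about distributing factors.
\<close>

definition Y :: "(nat \<times> nat) monomial monomial \<Rightarrow> nat list monomial" where
  "Y = extend (\<lambda>M. var (shape M))"

definition Z :: "nat \<Rightarrow> (nat \<times> nat) monomial monomial \<Rightarrow> nat monomial" where
  "Z i = extend (\<lambda>M. zpart i (se M))"

definition E :: "(nat \<times> nat) monomial monomial \<Rightarrow> (nat \<times> nat) multiset" where
  "E = extend (\<lambda>M. mset (se M))"

lemma YZE_add [simp]: "Y (u + v) = Y u + Y v" "Z i (u + v) = Z i u + Z i v" "E (u + v) = E u + E v"
  and YZE_zero [simp]: "Y 0 = 0" "Z i 0 = 0" "E 0 = {#}"
  and YZE_var [simp]: "Y (Poly_Mapping.single M (Suc 0)) = var (shape M)"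
     "Z i (Poly_Mapping.single M (Suc 0)) = zpart i (se M)" "E (Poly_Mapping.single M (Suc 0)) = mset (se M)"
  by (simp_all add: Y_def Z_def E_def)

lemma phi0_mon: "phi0 d A lam m lt G (mon u) = mon (Y u)"
  by (simp add: phi0_def X_def alg_hom_mon Y_def)

lemma phi_mon: "phi d A lam m lt G i (mon u) = mon (Z i u)"
  by (simp add: phi_def alg_hom_mon Z_def)

lemma Y_monomials: "u \<in> monomials N \<Longrightarrow> Y u \<in> monomials (yvars d A)"
  unfolding Y_def by (erule extend_monomials) (simp add: shape_yvars)

lemma Z_monomials: "u \<in> monomials N \<Longrightarrow> Z i u \<in> monomials {1..lam i}"
  unfolding Z_def by (erule extend_monomials) (rule zpart_se)

lemma count_E: "u \<in> monomials N \<Longrightarrow> count (E u) (i, j) = Poly_Mapping.lookup (Z i u) j"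
  by (induction rule: monomial_induct) (simp_all add: lookup_add lookup_zpart)

lemma Z_outside: "u \<in> monomials N \<Longrightarrow> i \<notin> {1..d} \<Longrightarrow> Z i u = 0"
  by (induction rule: monomial_induct) (simp_all add: zpart_outside se_factors del: atLeastAtMost_iff)

lemma E_eqI:
  assumes "u \<in> monomials N" "v \<in> monomials N" "\<And>i. i \<in> {1..d} \<Longrightarrow> Z i u = Z i v"
  shows "E u = E v"
proof (rule multiset_eqI)
  fix x
  have "Z i u = Z i v" for i
    using assms(3) Z_outside[OF assms(1)] Z_outside[OF assms(2)] by metis
  then show "count (E u) x = count (E v) x"
    using assms(1,2) by (cases x) (simp add: count_E)
qed

lemma lookup_shape: "u \<in> monomials N \<Longrightarrow> Poly_Mapping.lookup (extend tmon (Y u)) i = mdeg (Z i u)"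
  by (induction rule: monomial_induct) (simp_all add: lookup_add mdeg_zpart)

lemma mdeg_Y: "u \<in> monomials N \<Longrightarrow> mdeg (Y u) = mdeg u"
  by (induction rule: monomial_induct) simp_all

lemma lookup_pi:
  "u \<in> monomials N \<Longrightarrow> Poly_Mapping.lookup (extend (\<lambda>M. M) u) (i, l) =
    (if i \<in> {1..d} then Poly_Mapping.lookup (extend (m i) (Z i u)) (i, l) else 0)"
proof (induction rule: monomial_induct)
  case (var M u)
  then have "Poly_Mapping.lookup M (i, l) =
    (if i \<in> {1..d} then Poly_Mapping.lookup (extend (m i) (zpart i (se M))) (i, l) else 0)"
    using lookup_product[of "se M" i l] by (simp add: se_product se_factors)
  with var show ?case by (simp add: lookup_add)
qed simp

text \<open>
  The image of \<open>u\<close> under \<open>\<pi>\<close> splits into its blocks, one for each inner ring, and by \<open>lookup_pi\<close> the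
  \<open>i\<close>-th block is the image of \<open>\<phi>\<^sub>i u\<close> under \<open>\<pi>\<^sub>i\<close>.
\<close>

lemma same_product_iff:
  assumes "u \<in> monomials N" "v \<in> monomials N"
  shows "extend (\<lambda>M. M) u = extend (\<lambda>M. M) v \<longleftrightarrow> (\<forall>i\<in>{1..d}. extend (m i) (Z i u) = extend (m i) (Z i v))"
    (is "?L \<longleftrightarrow> ?R")
proof
  assume ?L
  show ?R
  proof (intro ballI poly_mapping_eqI)
    fix i and x :: "nat \<times> nat" assume i: "i \<in> {1..d}"
    obtain k l where x: "x = (k, l)" by force
    show "Poly_Mapping.lookup (extend (m i) (Z i u)) x = Poly_Mapping.lookup (extend (m i) (Z i v)) x"
    proof (cases "k = i")
      case True
      with \<open>?L\<close> i show ?thesis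
        using lookup_pi[OF assms(1), of i l] lookup_pi[OF assms(2), of i l] by (simp add: x)
    next
      case False
      then show ?thesis
        using lookup_other_block[OF i Z_monomials[OF assms(1)] False]
          lookup_other_block[OF i Z_monomials[OF assms(2)] False] by (simp add: x)
    qed
  qed
next
  assume R: ?R
  show ?L
  proof (rule poly_mapping_eqI)
    fix x
    show "Poly_Mapping.lookup (extend (\<lambda>M. M) u) x = Poly_Mapping.lookup (extend (\<lambda>M. M) v) x"
      using R by (cases x) (simp add: lookup_pi assms del: atLeastAtMost_iff)
  qed
qed

text \<open>
  The exponent of \<open>t\<^sub>i\<close> in \<open>\<pi>\<^sub>0 (\<phi>\<^sub>0 u)\<close> is the degree of \<open>\<phi>\<^sub>i u\<close>, and this degree is constant on the fibers of \<open>\<pi>\<^sub>i\<close>.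
\<close>

lemma same_product_shapes:
  assumes "u \<in> monomials N" "v \<in> monomials N" "extend (\<lambda>M. M) u = extend (\<lambda>M. M) v"
  shows "extend tmon (Y u) = extend tmon (Y v)"
proof (rule poly_mapping_eqI)
  fix i
  have "mdeg (Z i u) = mdeg (Z i v)"
  proof (cases "i \<in> {1..d}")
    case True
    then interpret toric_groebner "{1..lam i}" "m i" "lt i" "G i"
      by (rule toric_groebner_B)
    show ?thesis
      using assms True same_product_iff Z_monomials by (intro degree) auto
  qed (simp add: Z_outside assms del: atLeastAtMost_iff)
  then show "Poly_Mapping.lookup (extend tmon (Y u)) i = Poly_Mapping.lookup (extend tmon (Y v)) i"
    by (simp add: lookup_shape assms)
qed

lemma same_product_mdeg:
  assumes "u \<in> monomials N" "v \<in> monomials N" "extend (\<lambda>M. M) u = extend (\<lambda>M. M) v"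
  shows "mdeg u = mdeg v"
  using y.degree[OF _ _ same_product_shapes[OF assms]] assms by (simp add: Y_monomials mdeg_Y)

text \<open>
  In every fiber the standard monomial is unique, for \<open>\<G>\<^sub>0\<close> as well as for \<open>\<G>\<^sub>1, \<dots>, \<G>\<^sub>d\<close>.
\<close>

lemma standard_parts_eq:
  assumes "u \<in> monomials N" "v \<in> monomials N" "extend (\<lambda>M. M) u = extend (\<lambda>M. M) v"
    and "standard lt0 G0 (Y u)" "standard lt0 G0 (Y v)"
    and "\<And>i. i \<in> {1..d} \<Longrightarrow> standard (lt i) (G i) (Z i u)"
    and "\<And>i. i \<in> {1..d} \<Longrightarrow> standard (lt i) (G i) (Z i v)"
  shows "Y u = Y v" "E u = E v"
proof -
  show "Y u = Y v"
    using assms(4,5) same_product_shapes[OF assms(1-3)] Y_monomials[OF assms(1)] Y_monomials[OF assms(2)]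
    by (intro y.standard_unique) auto
  show "E u = E v"
  proof (rule E_eqI[OF assms(1,2)])
    fix i assume i: "i \<in> {1..d}"
    interpret toric_groebner "{1..lam i}" "m i" "lt i" "G i"
      using i by (rule toric_groebner_B)
    show "Z i u = Z i v"
      using assms i same_product_iff[OF assms(1,2)] Z_monomials[OF assms(1)] Z_monomials[OF assms(2)]
      by (intro standard_unique) auto
  qed
qed

text \<open>
  The parts of two standard expressions of \<open>M\<close> are standard and lie in the same fibers.
\<close>

lemma standard_expression_unique:
  assumes "standard_expression d A lam m lt G es M"
  shows "M \<in> N" "mset (se M) = mset es"
proof -
  have es: "factors_ok es" "M = product es" "expression d A lam m es M"
    using assms by (auto simp: standard_expression_def expression_iff)
  then show M: "M \<in> N" by (auto simp: nested_def)
  have product: "product (se M) = product es"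
    using se_product[OF M] es(2) by simp
  show "mset (se M) = mset es"
  proof (rule mset_eq_if_zparts[OF se_factors[OF M] es(1)])
    fix i assume i: "i \<in> {1..d}"
    interpret toric_groebner "{1..lam i}" "m i" "lt i" "G i"
      using i by (rule toric_groebner_B)
    have "extend (m i) (zpart i (se M)) = extend (m i) (zpart i es)"
    proof (rule poly_mapping_eqI)
      fix x :: "nat \<times> nat"
      obtain k l where x: "x = (k, l)" by force
      show "Poly_Mapping.lookup (extend (m i) (zpart i (se M))) x = Poly_Mapping.lookup (extend (m i) (zpart i es)) x"
      proof (cases "k = i")
        case True
        with i show ?thesis
          using lookup_product[OF es(1), of i l] lookup_product[OF se_factors[OF M], of i l]
          by (simp add: x product)
      next
        case False
        then show ?thesis
          using lookup_other_block[OF i zpart_se[OF M] False]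
            lookup_other_block[OF i zpart_factors[OF es(1)] False] by (simp add: x)
      qed
    qed
    then show "zpart i (se M) = zpart i es"
      using zpart_se[OF M] zpart_factors[OF es(1)] zpart_se_standard[OF M i] assms i
      by (intro standard_unique) (auto simp: standard_expression_def)
  qed
qed

end

section \<open>Aligned factors and enumerations\<close>

text \<open>
  For each entry \<open>i\<close> of the list, the pair \<open>(i, j)\<close> with the least \<open>j\<close> still available is chosen.
\<close>

lemma split_aligned:
  fixes E :: "(nat \<times> nat) multiset"
  assumes "mset is \<subseteq># image_mset fst E"
  shows "\<exists>Z R. E = Z + R \<and> image_mset fst Z = mset is \<and> (\<forall>i j l. (i, j) \<in># Z \<longrightarrow> (i, l) \<in># R \<longrightarrow> j \<le> l)"
  using assms
proof (induction "is")
  case Nil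
  show ?case by (rule exI[of _ "{#}"]) simp
next
  case (Cons i "is")
  have "mset is \<subseteq># mset (i # is)" by simp
  then have "mset is \<subseteq># image_mset fst E"
    using Cons.prems by (rule subset_mset.order_trans)
  from Cons.IH[OF this] obtain Z R where E: "E = Z + R" and Z: "image_mset fst Z = mset is"
    and al: "\<forall>i j l. (i, j) \<in># Z \<longrightarrow> (i, l) \<in># R \<longrightarrow> j \<le> l"
    by (elim exE conjE)
  have "{#i#} \<subseteq># image_mset fst R"
    using Cons.prems by (simp add: E Z)
  then have i: "i \<in> fst ` set_mset R" by simp
  define j where "j = (LEAST j. (i, j) \<in># R)"
  have j: "(i, j) \<in># R"
  proof -
    have "\<exists>j. (i, j) \<in># R" using i by force
    then show ?thesis unfolding j_def by (rule LeastI_ex)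
  qed
  have j_le: "j \<le> l" if "(i, l) \<in># R" for l
    unfolding j_def using that by (rule Least_le)
  obtain R' where R: "R = add_mset (i, j) R'"
    using j by (metis multi_member_split)
  show ?case
  proof (intro exI conjI allI impI)
    show "E = add_mset (i, j) Z + R'" by (simp add: E R)
    show "image_mset fst (add_mset (i, j) Z) = mset (i # is)" by (simp add: Z)
    show "j' \<le> l" if "(i', j') \<in># add_mset (i, j) Z" "(i', l) \<in># R'" for i' j' l
    proof (cases "(i', j') = (i, j)")
      case True
      then show ?thesis using j_le[of l] that(2) by (simp add: R)
    next
      case False
      then have "(i', j') \<in># Z" "(i', l) \<in># R" using that by (auto simp: R)
      then show ?thesis using al by blast
    qed
  qed
qed

context nested_configuration
begin

abbreviation "indices \<equiv> {1..card N}"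

lemma pi0_phi0: "pi0 (phi0 d A lam m lt G (X M)) = (mon (tmon (shape M)) :: (nat, 'k) mpoly)"
  by (simp add: X_def phi0_mon pi0_def alg_hom_mon)

lemma enumeration_iff:
  "enumeration d A lam m lt G Ms \<longleftrightarrow> bij_betw Ms indices N \<and>
    (\<forall>\<alpha>\<in>indices. \<forall>\<beta>\<in>indices. \<alpha> \<le> \<beta> \<longrightarrow> tmon (shape (Ms \<beta>)) \<le> tmon (shape (Ms \<alpha>)))"
  by (simp add: enumeration_def lex_ge_def pi0_phi0)

lemma ties_aligned_iff:
  "ties_aligned d A lam m lt G Ms \<longleftrightarrow> (\<forall>\<alpha>\<in>indices. \<forall>\<beta>\<in>indices.
     tmon (shape (Ms \<alpha>)) = tmon (shape (Ms \<beta>)) \<and> aligned (se (Ms \<alpha>)) (se (Ms \<beta>)) \<longrightarrow> \<alpha> \<le> \<beta>)"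
  by (simp add: ties_aligned_def pi0_phi0)

lemma shape_eq_iff: "M \<in> N \<Longrightarrow> M' \<in> N \<Longrightarrow> tmon (shape M) = tmon (shape M') \<longleftrightarrow> shape M = shape M'"
  using inj_onD[OF tmon_inj] shape_yvars by metis

text \<open>
  The version of \<open>aligned_minimal\<close> for variables of \<open>K[x]\<close>; a variable is determined by the factors in
  its standard expression.
\<close>

lemma aligned_weight:
  assumes M: "M1 \<in> N" "M1' \<in> N"
    and eq: "mset (se M1) + R = mset (se M1') + R'" and shape: "shape M1 = shape M1'"
    and aligned: "\<forall>i j l. (i, j) \<in># mset (se M1) \<longrightarrow> (i, l) \<in># R \<longrightarrow> j \<le> l"
  shows "sum_list (map snd (se M1)) \<le> sum_list (map snd (se M1'))"
    and "sum_list (map snd (se M1)) = sum_list (map snd (se M1')) \<Longrightarrow> M1 = M1'"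
proof -
  have img: "image_mset fst (mset (se M1)) = image_mset fst (mset (se M1'))"
    using shape by (metis mset_map)
  have sum: "sum_list (map snd (se M)) = sum_mset (image_mset snd (mset (se M)))" for M
    by (metis mset_map sum_mset_sum_list)
  note min = aligned_minimal[OF eq img aligned]
  show "sum_list (map snd (se M1)) \<le> sum_list (map snd (se M1'))"
    unfolding sum by (rule min(1))
  show "M1 = M1'" if "sum_list (map snd (se M1)) = sum_list (map snd (se M1'))"
    using min(2) that M se_inject unfolding sum by blast
qed

definition weight :: "(nat \<times> nat) monomial \<Rightarrow> nat" where
  "weight M = sum_list (map snd (se M))"

definition rank :: "(nat \<times> nat) monomial \<Rightarrow> nat" where
  "rank M = card {a \<in> A. tmon (shape M) < a}"

text \<open>
  The factor exceeds every weight, so keys compare lexicographically by rank and weight. The rank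
  counts greater elements of \<open>A\<close> because the enumeration is lexicographically decreasing.
\<close>

definition key :: "(nat \<times> nat) monomial \<Rightarrow> nat" where
  "key M = Suc (sum weight N) * rank M + weight M"

lemma weight_bound: "M \<in> N \<Longrightarrow> weight M < Suc (sum weight N)"
  using member_le_sum[of M N weight] finite_N by (simp add: le_imp_less_Suc)

lemma rank_less:
  assumes "M \<in> N" "M' \<in> N"
  shows "rank M < rank M' \<longleftrightarrow> tmon (shape M') < tmon (shape M)"
proof -
  have fin: "finite A" using config_A by (simp add: configuration_def)
  have mono: "rank M \<le> rank M'" if "tmon (shape M') \<le> tmon (shape M)" for M M'
    unfolding rank_def using that fin by (intro card_mono) auto
  have "rank M < rank M'" if "tmon (shape M') < tmon (shape M)"
    unfolding rank_def
  proof (rule psubset_card_mono)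
    show "{a \<in> A. tmon (shape M) < a} \<subset> {a \<in> A. tmon (shape M') < a}"
      using that tmon_shape[OF assms(1)] by auto
  qed (use fin in simp)
  with mono show ?thesis by (meson leD leI)
qed

lemma key_less:
  assumes "M \<in> N" "M' \<in> N" "rank M < rank M'"
  shows "key M < key M'"
proof -
  let ?C = "Suc (sum weight N)"
  have "key M < ?C * rank M + ?C"
    unfolding key_def using weight_bound[OF assms(1)] by simp
  also have "\<dots> = ?C * Suc (rank M)" by simp
  also have "\<dots> \<le> ?C * rank M'" using assms(3) by (intro mult_le_mono2) simp
  also have "\<dots> \<le> key M'" by (simp add: key_def)
  finally show ?thesis .
qed

lemma key_same_shape: "shape M = shape M' \<Longrightarrow> key M < key M' \<longleftrightarrow> weight M < weight M'"
  by (simp add: key_def rank_def)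

text \<open>
  Sorting by \<^term>\<open>key\<close> works: shapes come first, and among variables of the same shape an aligned
  pair has increasing weights, with equality only for equal variables.
\<close>

lemma ex_enumeration: "\<exists>Ms. enumeration d A lam m lt G Ms \<and> ties_aligned d A lam m lt G Ms"
proof -
  obtain ys where ys: "set ys = N" "distinct ys"
    using finite_distinct_list[OF finite_N] by blast
  define xs where "xs = sort_key key ys"
  have xs: "set xs = N" "distinct xs" "sorted (map key xs)"
    using ys by (simp_all add: xs_def)
  have len: "length xs = card N" using distinct_card[OF xs(2)] xs(1) by simp
  \<comment> \<open>Enumerations start at 1, lists at 0.\<close>
  define Ms where "Ms k = xs ! (k - 1)" for k
  have bij: "bij_betw Ms indices N"
  proof -
    have "bij_betw ((!) xs) {..<card N} N"
      using bij_betw_nth[OF xs(2)] xs(1) len by simp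
    moreover have "bij_betw (\<lambda>k. k - 1) indices {..<card N}"
      by (rule bij_betw_byWitness[where f' = Suc]) auto
    ultimately have "bij_betw ((!) xs \<circ> (\<lambda>k. k - 1)) indices N"
      by (rule bij_betw_trans[rotated])
    then show ?thesis by (simp add: Ms_def[abs_def] comp_def)
  qed
  have Ms: "Ms \<alpha> \<in> N" if "\<alpha> \<in> indices" for \<alpha>
    using bij that by (rule bij_betw_apply)
  have key_mono: "key (Ms \<alpha>) \<le> key (Ms \<beta>)" if "\<alpha> \<in> indices" "\<beta> \<in> indices" "\<alpha> \<le> \<beta>" for \<alpha> \<beta>
    using sorted_nth_mono[OF xs(3), of "\<alpha> - 1" "\<beta> - 1"] that len by (auto simp: Ms_def)
  have "tmon (shape (Ms \<beta>)) \<le> tmon (shape (Ms \<alpha>))" if "\<alpha> \<in> indices" "\<beta> \<in> indices" "\<alpha> \<le> \<beta>" for \<alpha> \<beta>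
  proof (rule ccontr)
    assume "\<not> ?thesis"
    then have "rank (Ms \<beta>) < rank (Ms \<alpha>)"
      using rank_less[OF Ms[OF that(2)] Ms[OF that(1)]] by (simp only: not_le)
    then have "key (Ms \<beta>) < key (Ms \<alpha>)"
      by (rule key_less[OF Ms[OF that(2)] Ms[OF that(1)]])
    with key_mono[OF that] show False by simp
  qed
  then have enum: "enumeration d A lam m lt G Ms"
    unfolding enumeration_iff using bij by (intro conjI ballI impI)
  have "\<alpha> \<le> \<beta>" if r: "\<alpha> \<in> indices" "\<beta> \<in> indices" and tie: "tmon (shape (Ms \<alpha>)) = tmon (shape (Ms \<beta>))"
    and al: "aligned (se (Ms \<alpha>)) (se (Ms \<beta>))" for \<alpha> \<beta>
  proof (rule ccontr)
    assume "\<not> \<alpha> \<le> \<beta>"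
    have sh: "shape (Ms \<alpha>) = shape (Ms \<beta>)"
      using tie shape_eq_iff[OF Ms[OF r(1)] Ms[OF r(2)]] by blast
    note w = aligned_weight[OF Ms[OF r(1)] Ms[OF r(2)] add.commute sh al[unfolded aligned_iff]]
    have "weight (Ms \<alpha>) \<le> weight (Ms \<beta>)"
      unfolding weight_def by (rule w(1))
    moreover have "\<not> weight (Ms \<alpha>) < weight (Ms \<beta>)"
      using key_mono[OF r(2,1)] \<open>\<not> \<alpha> \<le> \<beta>\<close> key_same_shape[OF sh] by simp
    ultimately have "weight (Ms \<alpha>) = weight (Ms \<beta>)" by linarith
    then have "Ms \<alpha> = Ms \<beta>"
      unfolding weight_def by (rule w(2))
    then show False
      using inj_on_eq_iff[OF bij_betw_imp_inj_on[OF bij] r] \<open>\<not> \<alpha> \<le> \<beta>\<close> by simp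
  qed
  then have "ties_aligned d A lam m lt G Ms"
    unfolding ties_aligned_iff by (intro ballI impI) (elim conjE)
  with enum show ?thesis by (intro exI conjI)
qed

end

subsection \<open>Pairwise aligned monomials\<close>

locale enumerated_configuration = nested_configuration d A mu lam m lt0 lt G0 G
  for d :: nat
    and A :: "nat monomial set"
    and mu lam :: "nat \<Rightarrow> nat"
    and m :: "nat \<Rightarrow> nat \<Rightarrow> (nat \<times> nat) monomial"
    and lt0 :: "nat list monomial \<Rightarrow> nat list monomial \<Rightarrow> bool"
    and lt :: "nat \<Rightarrow> nat monomial \<Rightarrow> nat monomial \<Rightarrow> bool"
    and G0 :: "(nat list, 'k::field) mpoly set"
    and G :: "nat \<Rightarrow> (nat, 'k) mpoly set" +
  fixes Ms :: "nat \<Rightarrow> (nat \<times> nat) monomial"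
  assumes enum: "enumeration d A lam m lt G Ms" and ties: "ties_aligned d A lam m lt G Ms"
begin

lemma bij_Ms: "bij_betw Ms indices N"
  using enum by (simp add: enumeration_iff)

lemma Ms_in: "\<alpha> \<in> indices \<Longrightarrow> Ms \<alpha> \<in> N"
  by (rule bij_betw_apply[OF bij_Ms])

lemma Ms_inject: "\<alpha> \<in> indices \<Longrightarrow> \<beta> \<in> indices \<Longrightarrow> Ms \<alpha> = Ms \<beta> \<longleftrightarrow> \<alpha> = \<beta>"
  by (rule inj_on_eq_iff[OF bij_betw_imp_inj_on[OF bij_Ms]])

lemma Ms_surj:
  assumes "M \<in> N"
  obtains \<alpha> where "\<alpha> \<in> indices" "M = Ms \<alpha>"
proof -
  have "M \<in> Ms ` indices"
    using assms by (simp only: bij_betw_imp_surj_on[OF bij_Ms])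
  then show thesis by (elim imageE) (rule that)
qed

lemma Ms_lex: "\<alpha> \<in> indices \<Longrightarrow> \<beta> \<in> indices \<Longrightarrow> \<alpha> \<le> \<beta> \<Longrightarrow> tmon (shape (Ms \<beta>)) \<le> tmon (shape (Ms \<alpha>))"
  using enum unfolding enumeration_iff by blast

lemma Ms_ties:
  "\<alpha> \<in> indices \<Longrightarrow> \<beta> \<in> indices \<Longrightarrow> tmon (shape (Ms \<alpha>)) = tmon (shape (Ms \<beta>)) \<Longrightarrow>
    aligned (se (Ms \<alpha>)) (se (Ms \<beta>)) \<Longrightarrow> \<alpha> \<le> \<beta>"
  using ties unfolding ties_aligned_iff by blast

definition pairwise_aligned :: "(nat \<times> nat) monomial monomial \<Rightarrow> bool" where
  "pairwise_aligned u \<longleftrightarrow> (\<forall>\<alpha>\<in>indices. \<forall>\<beta>\<in>indices. \<alpha> \<le> \<beta> \<longrightarrow>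
     divides (var (Ms \<alpha>) + var (Ms \<beta>)) u \<longrightarrow> aligned (se (Ms \<alpha>)) (se (Ms \<beta>)))"

lemma first_factor:
  assumes "u \<in> monomials N" "u \<noteq> 0"
  obtains \<alpha> u' where "\<alpha> \<in> indices" "u = var (Ms \<alpha>) + u'"
    "\<forall>\<beta>\<in>indices. \<forall>u''. u = var (Ms \<beta>) + u'' \<longrightarrow> \<alpha> \<le> \<beta>"
proof -
  let ?P = "\<lambda>\<alpha>. \<alpha> \<in> indices \<and> (\<exists>u'. u = var (Ms \<alpha>) + u')"
  obtain M u' where "u = var M + u'"
    using assms(2) by (rule nonzero_monomialE)
  moreover from this obtain \<alpha> where "\<alpha> \<in> indices" "M = Ms \<alpha>"
    using assms(1) Ms_surj[of M] by auto
  ultimately have "\<exists>\<alpha>. ?P \<alpha>" by blast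
  then have "?P (Least ?P)" by (rule LeastI_ex)
  moreover have "Least ?P \<le> \<beta>" if "?P \<beta>" for \<beta>
    using that by (rule Least_le)
  ultimately show thesis using that by blast
qed

lemma mem_E:
  "u \<in> monomials N \<Longrightarrow> x \<in># E u \<Longrightarrow> \<exists>M u'. u = var M + u' \<and> x \<in># mset (se M)"
proof (induction rule: monomial_induct)
  case (var M u)
  show ?case
  proof (cases "x \<in># mset (se M)")
    case True
    then show ?thesis by blast
  next
    case False
    then obtain M' u' where "u = var M' + u'" "x \<in># mset (se M')"
      using var by auto
    moreover from this have "var M + u = var M' + (var M + u')" by (simp add: ac_simps)
    ultimately show ?thesis by blast
  qed
qed simp

lemma mem_Y:
  assumes "u \<in> monomials N" "Y u = var I + b"
  obtains M u' where "u = var M + u'" "shape M = I"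
proof -
  have "divides (var I) (extend (\<lambda>M. var (shape M)) u)"
    using assms(2) by (auto simp: divides_def Y_def)
  then obtain M u' c where M: "u = var M + u'" "var (shape M) = var I + c"
    by (rule var_divides_extend[OF assms(1)])
  have "I \<in> Poly_Mapping.keys (var (shape M))"
    unfolding M(2) by (simp add: in_keys_iff lookup_add)
  then have "shape M = I" by simp
  with M(1) show thesis by (rule that)
qed

text \<open>
  The first variable of \<open>u\<close> in the enumeration has the lexicographically greatest shape that occurs in \<open>Y u\<close>, and being
  aligned with all the others it holds the smallest of the factors in \<open>E u\<close>. The same holds for \<open>v\<close>, so
  the first variables agree and can be cancelled.
\<close>

lemma pairwise_aligned_unique:
  assumes "u \<in> monomials N" "v \<in> monomials N" "pairwise_aligned u" "pairwise_aligned v" "Y u = Y v" "E u = E v"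
  shows "u = v"
  using assms
proof (induction "mdeg u" arbitrary: u v)
  case 0
  then have "mdeg v = 0" using mdeg_Y[of u] mdeg_Y[of v] by simp
  with 0 show ?case by simp
next
  case (Suc n)
  have nz: "u \<noteq> 0" "v \<noteq> 0"
    using Suc.hyps(2) mdeg_Y[OF Suc.prems(1)] mdeg_Y[OF Suc.prems(2)] Suc.prems(5) by auto
  obtain \<alpha> u' where u: "\<alpha> \<in> indices" "u = var (Ms \<alpha>) + u'"
      "\<forall>\<gamma>\<in>indices. \<forall>u''. u = var (Ms \<gamma>) + u'' \<longrightarrow> \<alpha> \<le> \<gamma>"
    using first_factor[OF Suc.prems(1) nz(1)] by blast
  obtain \<beta> v' where v: "\<beta> \<in> indices" "v = var (Ms \<beta>) + v'"
      "\<forall>\<gamma>\<in>indices. \<forall>u''. v = var (Ms \<gamma>) + u'' \<longrightarrow> \<beta> \<le> \<gamma>"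
    using first_factor[OF Suc.prems(2) nz(2)] by blast
  \<comment> \<open>Every shape in \<open>Y v\<close> belongs to some variable of \<open>v\<close>, which does not precede \<open>Ms \<beta>\<close>.\<close>
  have lex: "tmon (shape (Ms \<alpha>)) \<le> tmon (shape (Ms \<beta>))"
    if v: "\<beta> \<in> indices" "v \<in> monomials N" "\<forall>\<gamma>\<in>indices. \<forall>u''. v = var (Ms \<gamma>) + u'' \<longrightarrow> \<beta> \<le> \<gamma>"
      and Y: "Y v = var (shape (Ms \<alpha>)) + b" for \<alpha> \<beta> v b
  proof -
    obtain M v'' where M: "v = var M + v''" "shape M = shape (Ms \<alpha>)"
      using mem_Y[OF v(2) Y] by blast
    then obtain \<gamma> where \<gamma>: "\<gamma> \<in> indices" "M = Ms \<gamma>"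
      using v(2) Ms_surj[of M] by auto
    then have "\<beta> \<le> \<gamma>" using v(3) M(1) by blast
    then show ?thesis using Ms_lex[OF v(1) \<gamma>(1)] M(2) \<gamma>(2) by simp
  qed
  have "tmon (shape (Ms \<alpha>)) = tmon (shape (Ms \<beta>))"
  proof (rule antisym)
    show "tmon (shape (Ms \<alpha>)) \<le> tmon (shape (Ms \<beta>))"
      by (rule lex[OF v(1) Suc.prems(2) v(3), where b = "Y u'"]) (use Suc.prems(5) u(2) in simp_all)
    show "tmon (shape (Ms \<beta>)) \<le> tmon (shape (Ms \<alpha>))"
      by (rule lex[OF u(1) Suc.prems(1) u(3), where b = "Y v'"]) (use Suc.prems(5) v(2) in simp_all)
  qed
  then have shape: "shape (Ms \<alpha>) = shape (Ms \<beta>)"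
    using shape_eq_iff Ms_in u(1) v(1) by blast
  have al: "\<forall>i j l. (i, j) \<in># mset (se (Ms \<alpha>)) \<longrightarrow> (i, l) \<in># E u' \<longrightarrow> j \<le> l"
    if u: "\<alpha> \<in> indices" "u = var (Ms \<alpha>) + u'" "\<forall>\<gamma>\<in>indices. \<forall>u''. u = var (Ms \<gamma>) + u'' \<longrightarrow> \<alpha> \<le> \<gamma>"
      "u \<in> monomials N" "pairwise_aligned u" for \<alpha> u u'
  proof (intro allI impI)
    fix i j l assume ij: "(i, j) \<in># mset (se (Ms \<alpha>))" "(i, l) \<in># E u'"
    have "u' \<in> monomials N" using u(2,4) by simp
    then obtain M u'' where M: "u' = var M + u''" "(i, l) \<in># mset (se M)"
      using mem_E ij(2) by blast
    then obtain \<gamma> where \<gamma>: "\<gamma> \<in> indices" "M = Ms \<gamma>"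
      using u(2,4) Ms_surj[of M] by auto
    have "u = var (Ms \<gamma>) + (var (Ms \<alpha>) + u'')"
      using u(2) M(1) \<gamma>(2) by (simp add: ac_simps)
    then have "\<alpha> \<le> \<gamma>" using u(3) \<gamma>(1) by blast
    moreover have "divides (var (Ms \<alpha>) + var (Ms \<gamma>)) u"
      using u(2) M(1) \<gamma>(2) by (auto simp: divides_def add.assoc)
    ultimately have "aligned (se (Ms \<alpha>)) (se (Ms \<gamma>))"
      using u(1,5) \<gamma>(1) unfolding pairwise_aligned_def by blast
    then show "j \<le> l" using ij(1) M(2) \<gamma>(2) by (auto simp: aligned_iff)
  qed
  have eq: "mset (se (Ms \<alpha>)) + E u' = mset (se (Ms \<beta>)) + E v'"
    using Suc.prems(6) u(2) v(2) by simp
  note wu = aligned_weight[OF Ms_in[OF u(1)] Ms_in[OF v(1)] eq shape al[OF u Suc.prems(1,3)]]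
  note wv = aligned_weight[OF Ms_in[OF v(1)] Ms_in[OF u(1)] eq[symmetric] shape[symmetric] al[OF v Suc.prems(2,4)]]
  have M: "Ms \<alpha> = Ms \<beta>"
    using wu wv(1) by simp
  have "u' = v'"
  proof (rule Suc.hyps(1))
    show "n = mdeg u'" using Suc.hyps(2) u(2) by simp
    show "u' \<in> monomials N" "v' \<in> monomials N" using Suc.prems(1,2) u(2) v(2) by simp_all
    show "Y u' = Y v'" "E u' = E v'" using Suc.prems(5,6) u(2) v(2) M by simp_all
    have "divides a (var L + w')" if "divides a w'" for a w' :: "(nat \<times> nat) monomial monomial" and L
      using that unfolding divides_def by (metis add.left_commute)
    then have "pairwise_aligned w'" if "pairwise_aligned (var L + w')" for w' L
      using that unfolding pairwise_aligned_def by blast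
    then show "pairwise_aligned u'" "pairwise_aligned v'"
      using Suc.prems(3,4) u(2) v(2) by simp_all
  qed
  with M u(2) v(2) show ?case by simp
qed

end

section \<open>The quadratic binomials\<close>

lemma var_pair_eq:
  assumes "var x + var y = var z + var w"
  shows "z = x \<and> w = y \<or> z = y \<and> w = x"
proof -
  have "count {#x, y#} v = count {#z, w#} v" for v
    using arg_cong[OF assms, of "\<lambda>p. Poly_Mapping.lookup p v"]
    by (simp add: lookup_add lookup_single when_def split: if_splits)
  then have "{#x, y#} = {#z, w#}" by (rule multiset_eqI)
  then show ?thesis by (auto simp: add_eq_conv_ex)
qed

context enumerated_configuration
begin

abbreviation "rel \<equiv> related d A lam m lt0 G0 lt G Ms"

abbreviation pair :: "nat \<Rightarrow> nat \<Rightarrow> (nat \<times> nat) monomial monomial" where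
  "pair \<alpha> \<beta> \<equiv> var (Ms \<alpha>) + var (Ms \<beta>)"

lemma X_mult: "X M * X M' = mon (var M + var M')"
  by (simp add: X_def mon_add)

lemma pair_monomials: "\<alpha> \<in> indices \<Longrightarrow> \<beta> \<in> indices \<Longrightarrow> pair \<alpha> \<beta> \<in> monomials N"
  by (simp add: Ms_in del: atLeastAtMost_iff)

lemma normal_form_Z_iff:
  assumes "i \<in> {1..d}" "u \<in> monomials N" "v \<in> monomials N"
  shows "normal_form (lt i) (G i) (mon (Z i u)) (mon (Z i v)) \<longleftrightarrow>
    standard (lt i) (G i) (Z i v) \<and> extend (m i) (Z i u) = extend (m i) (Z i v)"
proof -
  interpret toric_groebner "{1..lam i}" "m i" "lt i" "G i"
    using assms(1) by (rule toric_groebner_B)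
  show ?thesis by (rule normal_form_mon_iff[OF Z_monomials[OF assms(2)] Z_monomials[OF assms(3)]])
qed

definition reduced_parts :: "(nat \<times> nat) monomial monomial \<Rightarrow> bool" where
  "reduced_parts u \<longleftrightarrow> standard lt0 G0 (Y u) \<and> (\<forall>i\<in>{1..d}. standard (lt i) (G i) (Z i u))"

text \<open>
  The conditions on the \<open>\<phi>\<^sub>i\<close> with \<open>i \<ge> 1\<close> say that both products have the same image under \<open>\<pi>\<close>, and this
  implies the fiber condition on \<open>\<phi>\<^sub>0\<close>. What is left are standardness and alignment.
\<close>

lemma related_iff:
  "rel \<alpha> \<beta> \<gamma> \<delta> \<longleftrightarrow> {\<alpha>, \<beta>, \<gamma>, \<delta>} \<subseteq> indices \<and> \<gamma> \<le> \<delta> \<and>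
     extend (\<lambda>M. M) (pair \<alpha> \<beta>) = extend (\<lambda>M. M) (pair \<gamma> \<delta>) \<and>
     reduced_parts (pair \<gamma> \<delta>) \<and> aligned (se (Ms \<gamma>)) (se (Ms \<delta>))"
proof (cases "{\<alpha>, \<beta>, \<gamma>, \<delta>} \<subseteq> indices")
  case True
  then have mem: "pair \<alpha> \<beta> \<in> monomials N" "pair \<gamma> \<delta> \<in> monomials N"
    by (intro pair_monomials; blast)+
  have "normal_form lt0 G0 (mon (Y (pair \<alpha> \<beta>))) (mon (Y (pair \<gamma> \<delta>))) \<longleftrightarrow>
      standard lt0 G0 (Y (pair \<gamma> \<delta>)) \<and> extend tmon (Y (pair \<alpha> \<beta>)) = extend tmon (Y (pair \<gamma> \<delta>))"
    by (rule y.normal_form_mon_iff[OF Y_monomials[OF mem(1)] Y_monomials[OF mem(2)]])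
  moreover have "(\<forall>i\<in>{1..d}. normal_form (lt i) (G i) (mon (Z i (pair \<alpha> \<beta>))) (mon (Z i (pair \<gamma> \<delta>)))) \<longleftrightarrow>
      (\<forall>i\<in>{1..d}. standard (lt i) (G i) (Z i (pair \<gamma> \<delta>))) \<and> extend (\<lambda>M. M) (pair \<alpha> \<beta>) = extend (\<lambda>M. M) (pair \<gamma> \<delta>)"
    unfolding same_product_iff[OF mem] using normal_form_Z_iff[OF _ mem] by blast
  moreover note same_product_shapes[OF mem]
  ultimately show ?thesis
    unfolding related_def X_mult phi0_mon phi_mon reduced_parts_def by blast
next
  case False
  then show ?thesis unfolding related_def by blast
qed

lemma related_pairwise_aligned:
  assumes "rel \<alpha> \<beta> \<gamma> \<delta>"
  shows "pairwise_aligned (pair \<gamma> \<delta>)"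
  unfolding pairwise_aligned_def
proof (intro ballI impI)
  fix \<alpha>' \<beta>' assume r: "\<alpha>' \<in> indices" "\<beta>' \<in> indices" "\<alpha>' \<le> \<beta>'"
    and "divides (pair \<alpha>' \<beta>') (pair \<gamma> \<delta>)"
  then obtain c where c: "pair \<gamma> \<delta> = pair \<alpha>' \<beta>' + c" by (auto simp: divides_def)
  then have "mdeg (pair \<gamma> \<delta>) = mdeg (pair \<alpha>' \<beta>' + c)" by simp
  then have "c = 0" by simp
  with c have eq: "pair \<gamma> \<delta> = pair \<alpha>' \<beta>'" by simp
  have r': "\<gamma> \<in> indices" "\<delta> \<in> indices" and al: "\<gamma> \<le> \<delta>" "aligned (se (Ms \<gamma>)) (se (Ms \<delta>))"
    using assms by (auto simp: related_def)
  have "Ms \<alpha>' = Ms \<gamma> \<and> Ms \<beta>' = Ms \<delta> \<or> Ms \<alpha>' = Ms \<delta> \<and> Ms \<beta>' = Ms \<gamma>"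
    using eq by (rule var_pair_eq)
  then have "\<alpha>' = \<gamma> \<and> \<beta>' = \<delta> \<or> \<alpha>' = \<delta> \<and> \<beta>' = \<gamma>"
    using Ms_inject r(1,2) r' by blast
  with al r(3) show "aligned (se (Ms \<alpha>')) (se (Ms \<beta>'))" by auto
qed

text \<open>
  Standard images determine all \<open>\<phi>\<^sub>j u\<close>, and alignment determines \<open>u\<close> from them.
\<close>

lemma standard_monomial_unique:
  assumes "u \<in> monomials N" "v \<in> monomials N" "extend (\<lambda>M. M) u = extend (\<lambda>M. M) v"
    and "reduced_parts u" "reduced_parts v" "pairwise_aligned u" "pairwise_aligned v"
  shows "u = v"
proof (rule pairwise_aligned_unique)
  show "Y u = Y v" "E u = E v"
    using standard_parts_eq[OF assms(1-3)] assms(4,5) by (auto simp: reduced_parts_def)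
qed (use assms in auto)

text \<open>
  The normal form of \<open>\<phi>\<^sub>0\<close> provides two shapes \<open>I\<close> and \<open>J\<close>, the normal forms of the other \<open>\<phi>\<^sub>i\<close> provide
  the factors. By the degree count, the factors fill \<open>I\<close> and \<open>J\<close> exactly; the lexicographically
  greater shape receives the smaller indices. Since parts of a standard monomial are standard, the two
  resulting expressions are standard expressions of variables of \<open>K[x]\<close>.
\<close>

lemma ex_related:
  assumes "\<alpha> \<in> indices" "\<beta> \<in> indices"
  shows "\<exists>\<gamma> \<delta>. rel \<alpha> \<beta> \<gamma> \<delta>"
proof -
  define a where "a = pair \<alpha> \<beta>"
  have a: "a \<in> monomials N" unfolding a_def using assms by (rule pair_monomials)
  obtain b0 where b0: "y.same_fiber b0 (Y a)" "standard lt0 G0 b0"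
    using y.ex_standard[OF Y_monomials[OF a]] by blast
  have "mdeg b0 = 2"
    using y.degree[of b0 "Y a"] b0(1) mdeg_Y[OF a] by (simp add: a_def)
  then obtain I0 J0 where IJ0: "b0 = var I0 + var J0" by (rule mdeg_two)
  obtain I J where IJ: "b0 = var I + var J" "tmon J \<le> tmon I"
  proof (cases "tmon J0 \<le> tmon I0")
    case True
    with IJ0 show ?thesis by (rule that)
  next
    case False
    have "b0 = var J0 + var I0" unfolding IJ0 by (rule add.commute)
    then show ?thesis by (rule that) (use False in simp)
  qed
  have IJ_y: "I \<in> yvars d A" "J \<in> yvars d A" using b0(1) IJ(1) by simp_all
  have "\<exists>b. b \<in> monomials {1..lam i} \<and> extend (m i) b = extend (m i) (Z i a) \<and> standard (lt i) (G i) b"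
    if "i \<in> {1..d}" for i
  proof -
    interpret toric_groebner "{1..lam i}" "m i" "lt i" "G i"
      using that by (rule toric_groebner_B)
    show ?thesis using ex_standard[OF Z_monomials[OF a]] by blast
  qed
  then obtain b where b: "\<And>i. i \<in> {1..d} \<Longrightarrow> b i \<in> monomials {1..lam i}"
    "\<And>i. i \<in> {1..d} \<Longrightarrow> extend (m i) (b i) = extend (m i) (Z i a)"
    "\<And>i. i \<in> {1..d} \<Longrightarrow> standard (lt i) (G i) (b i)"
    by metis
  obtain es where es: "\<And>i j. (i, j) \<in> set es \<Longrightarrow> i \<in> {1..d} \<and> j \<in> {1..lam i}"
      "\<And>i. i \<in> {1..d} \<Longrightarrow> zpart i es = b i"
    using ex_expression_list[of "{1..d}" b "\<lambda>i. {1..lam i}", OF _ b(1)] by blast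
  have ok: "factors_ok es" using es(1) by (simp add: factors_ok_def)
  have "tmon (map fst es) = extend tmon (Y a)"
  proof (rule poly_mapping_eqI)
    fix i
    show "Poly_Mapping.lookup (tmon (map fst es)) i = Poly_Mapping.lookup (extend tmon (Y a)) i"
    proof (cases "i \<in> {1..d}")
      case True
      then interpret toric_groebner "{1..lam i}" "m i" "lt i" "G i"
        by (rule toric_groebner_B)
      have "mdeg (b i) = mdeg (Z i a)"
        using b(1,2)[OF True] Z_monomials[OF a] by (intro degree)
      then show ?thesis using es(2)[OF True] by (simp add: lookup_shape[OF a] flip: mdeg_zpart)
    next
      case False
      then show ?thesis
        by (simp only: lookup_shape[OF a] mdeg_zpart[symmetric] Z_outside[OF a False] zpart_outside[OF ok False])
    qed
  qed
  also have "\<dots> = tmon (I @ J)" using b0(1) by (simp add: IJ(1) tmon_def)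
  finally have fst_es: "image_mset fst (mset es) = mset I + mset J"
    by (simp add: tmon_eq_iff)
  then obtain P R where PR: "mset es = P + R" "image_mset fst P = mset I"
    and al: "\<forall>i j l. (i, j) \<in># P \<longrightarrow> (i, l) \<in># R \<longrightarrow> j \<le> l"
    using split_aligned[of I "mset es"] by auto
  have R: "image_mset fst R = mset J" using fst_es PR by simp
  \<comment> \<open>A part of \<open>es\<close> with the shape of a variable of \<open>K[y]\<close> is the standard expression of a variable of \<open>K[x]\<close>.\<close>
  have factor: "\<exists>\<gamma>\<in>indices. shape (Ms \<gamma>) = K \<and> mset (se (Ms \<gamma>)) = Q"
    if K: "K \<in> yvars d A" and Q: "Q \<subseteq># mset es" "image_mset fst Q = mset K" for K Q
  proof -
    obtain qs where "mset qs = Q" using ex_mset by blast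
    obtain fs where "mset fs = mset qs" and sorted: "sorted (map fst fs)"
      by (rule sorted_by_fst)
    then have fs: "mset fs = Q" using \<open>mset qs = Q\<close> by simp
    have K': "sorted K" "K \<noteq> []" "tmon K \<in> A" using K by (auto simp: yvars_def)
    have "mset (map fst fs) = mset K" using Q(2) fs by simp
    then have fst_fs: "map fst fs = K" using sorted K'(1) by (metis properties_for_sort)
    have "set_mset (mset fs) \<subseteq> set_mset (mset es)" using Q(1) unfolding fs by (rule set_mset_mono)
    then have "factors_ok fs" using ok by (auto simp: factors_ok_def)
    then have "expression d A lam m fs (product fs)"
      using fst_fs K' by (auto simp: expression_iff)
    moreover have "standard (lt i) (G i) (zpart i fs)" if "i \<in> {1..d}" for i
    proof (rule standard_divides)
      show "standard (lt i) (G i) (zpart i es)" using b(3) es(2) that by simp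
      obtain gs where "mset gs = mset es - Q" using ex_mset by blast
      then have "mset es = mset (fs @ gs)" using fs Q(1) by simp
      then have "zpart i es = zpart i (fs @ gs)" by (rule zpart_cong)
      then have "zpart i es = zpart i fs + zpart i gs" by simp
      then show "divides (zpart i fs) (zpart i es)" by (auto simp: divides_def)
    qed
    ultimately have std: "standard_expression d A lam m lt G fs (product fs)"
      by (simp add: standard_expression_def)
    note M = standard_expression_unique[OF std]
    have "mset (shape (product fs)) = mset K" using M(2) fst_fs by (metis mset_map)
    then have "shape (product fs) = K" using se(2)[OF M(1)] K'(1) by (metis properties_for_sort)
    moreover obtain \<gamma> where "\<gamma> \<in> indices" "product fs = Ms \<gamma>" using Ms_surj[OF M(1)] .
    ultimately show ?thesis using M(2) fs by auto
  qed
  obtain \<gamma> where \<gamma>: "\<gamma> \<in> indices" "shape (Ms \<gamma>) = I" "mset (se (Ms \<gamma>)) = P"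
    using factor[OF IJ_y(1) _ PR(2)] PR(1) by auto
  obtain \<delta> where \<delta>: "\<delta> \<in> indices" "shape (Ms \<delta>) = J" "mset (se (Ms \<delta>)) = R"
    using factor[OF IJ_y(2) _ R] PR(1) by auto
  have aligned: "aligned (se (Ms \<gamma>)) (se (Ms \<delta>))"
    unfolding aligned_iff \<gamma>(3) \<delta>(3) by (rule al)
  have Z: "Z i (pair \<gamma> \<delta>) = b i" if "i \<in> {1..d}" for i
  proof -
    have "mset (se (Ms \<gamma>) @ se (Ms \<delta>)) = mset es" using PR(1) \<gamma>(3) \<delta>(3) by simp
    then have "zpart i (se (Ms \<gamma>) @ se (Ms \<delta>)) = zpart i es" by (rule zpart_cong)
    then show ?thesis using es(2)[OF that] by simp
  qed
  have "\<gamma> \<le> \<delta>"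
  proof (rule ccontr)
    assume "\<not> \<gamma> \<le> \<delta>"
    then have "tmon (shape (Ms \<gamma>)) \<le> tmon (shape (Ms \<delta>))"
      using Ms_lex[OF \<delta>(1) \<gamma>(1)] by simp
    then have "tmon (shape (Ms \<gamma>)) = tmon (shape (Ms \<delta>))"
      using IJ(2) \<gamma>(2) \<delta>(2) by simp
    then have "\<gamma> \<le> \<delta>" using Ms_ties[OF \<gamma>(1) \<delta>(1)] aligned by blast
    with \<open>\<not> \<gamma> \<le> \<delta>\<close> show False ..
  qed
  moreover have "extend (\<lambda>M. M) a = extend (\<lambda>M. M) (pair \<gamma> \<delta>)"
    unfolding same_product_iff[OF a pair_monomials[OF \<gamma>(1) \<delta>(1)]] using Z b(2) by simp
  moreover have "reduced_parts (pair \<gamma> \<delta>)"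
    using b0(2) b(3) Z \<gamma>(2) \<delta>(2) IJ(1) by (simp add: reduced_parts_def del: YZE_add(2))
  ultimately show ?thesis
    using assms \<gamma>(1) \<delta>(1) aligned unfolding related_iff a_def by blast
qed

end

section \<open>The monomial order\<close>

lemma sum_squares_less:
  fixes a b k l :: nat
  assumes "a + b = k + l" "k < a" "k < b"
  shows "a\<^sup>2 + b\<^sup>2 < k\<^sup>2 + l\<^sup>2"
proof -
  obtain x where a: "a = k + Suc x" using less_imp_Suc_add[OF assms(2)] by auto
  obtain y where b: "b = k + Suc y" using less_imp_Suc_add[OF assms(3)] by auto
  have l: "l = k + Suc x + Suc y" using assms(1) by (simp add: a b)
  show ?thesis by (simp add: a b l power2_eq_square algebra_simps)
qed

context enumerated_configuration
begin

text \<open>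
  A sum of squares that has to increase is turned into a nonnegative weight that decreases, as a monomial
  order requires; the constant is harmless because only monomials of equal degree are compared by it.
\<close>

definition spread :: "(nat \<times> nat) monomial \<Rightarrow> nat" where
  "spread M = (\<Sum>M'\<in>N. (key M')\<^sup>2) - (key M)\<^sup>2"

definition base_order :: "(nat \<times> nat) monomial monomial \<Rightarrow> (nat \<times> nat) monomial monomial \<Rightarrow> bool" where
  "base_order = refine (extend spread) (<) (<)"

definition inner_order ::
  "nat list \<Rightarrow> (nat \<times> nat) monomial monomial \<Rightarrow> (nat \<times> nat) monomial monomial \<Rightarrow> bool" where
  "inner_order is = foldr (\<lambda>i. refine (Z i) (lt i)) is base_order"

text \<open>
  The maps \<open>\<phi>\<^sub>0, \<dots>, \<phi>\<^sub>d\<close> are compared first, since passing to normal forms never makes them larger; the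
  weight decides when they agree. The lexicographic order at the end only makes the order total.
\<close>

definition ord :: "(nat \<times> nat) monomial monomial \<Rightarrow> (nat \<times> nat) monomial monomial \<Rightarrow> bool" where
  "ord = refine Y lt0 (inner_order [1..<Suc d])"

lemma inner_order_monomial_order: "set is \<subseteq> {1..d} \<Longrightarrow> monomial_order N (inner_order is)"
proof (induction "is")
  case Nil
  show ?case
    unfolding inner_order_def base_order_def
    using refine_weight_monomial_order[OF lex_monomial_order] by simp
next
  case (Cons i "is")
  then have IH: "monomial_order N (inner_order is)" and i: "i \<in> {1..d}" by simp_all
  have "monomial_order N (refine (Z i) (lt i) (inner_order is))"
    unfolding Z_def by (rule refine_monomial_order[OF IH order_B[OF i] zpart_se])
  then show ?case by (simp add: inner_order_def)
qed

lemma ord_monomial_order: "monomial_order N ord"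
  unfolding ord_def Y_def
  by (rule refine_monomial_order[OF inner_order_monomial_order order_A]) (auto simp: shape_yvars)

lemma inner_order_less:
  assumes "\<And>i. i \<in> set is \<Longrightarrow> Z i c \<noteq> Z i a \<Longrightarrow> lt i (Z i c) (Z i a)"
    and "(\<And>i. i \<in> set is \<Longrightarrow> Z i c = Z i a) \<Longrightarrow> base_order c a"
  shows "inner_order is c a"
  using assms
proof (induction "is")
  case (Cons i "is")
  show ?case
  proof (cases "Z i c = Z i a")
    case True
    then have "inner_order is c a"
      using Cons.prems by (intro Cons.IH) auto
    with True show ?thesis by (simp add: inner_order_def refine_def)
  next
    case False
    then show ?thesis using Cons.prems(1)[of i] by (simp add: inner_order_def refine_def)
  qed
qed (simp add: inner_order_def)

text \<open>
  For a fixed sum of two numbers, the sum of squares grows when they move apart. Since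
  \<open>\<gamma>\<close> and \<open>\<delta>\<close> carry the same shapes and factors as \<open>\<alpha>\<close> and \<open>\<beta>\<close>, the sum of the keys is the same, and
  it suffices that \<open>\<gamma>\<close> has a strictly smaller key than both \<open>\<alpha>\<close> and \<open>\<beta>\<close>. A variable of
  the same shape as \<open>\<gamma>\<close> has a greater weight by \<open>aligned_minimal\<close>, one of
  another shape has the shape of \<open>\<delta>\<close> and thus a greater rank, as \<open>\<gamma> \<le> \<delta>\<close>.
\<close>

lemma key_squares_less:
  assumes idx: "\<alpha> \<in> indices" "\<beta> \<in> indices" "\<gamma> \<in> indices" "\<delta> \<in> indices" and "\<gamma> \<le> \<delta>"
    and al: "aligned (se (Ms \<gamma>)) (se (Ms \<delta>))"
    and shape: "shape (Ms \<gamma>) = shape (Ms \<alpha>)" "shape (Ms \<delta>) = shape (Ms \<beta>)"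
    and E: "E (pair \<alpha> \<beta>) = E (pair \<gamma> \<delta>)" and neq: "pair \<alpha> \<beta> \<noteq> pair \<gamma> \<delta>"
  shows "(key (Ms \<alpha>))\<^sup>2 + (key (Ms \<beta>))\<^sup>2 < (key (Ms \<gamma>))\<^sup>2 + (key (Ms \<delta>))\<^sup>2"
proof -
  have eq: "mset (se (Ms \<gamma>)) + mset (se (Ms \<delta>)) = mset (se (Ms \<alpha>)) + mset (se (Ms \<beta>))"
    using E by simp
  have sum_weight: "weight M = sum_mset (image_mset snd (mset (se M)))" for M
    unfolding weight_def by (metis mset_map sum_mset_sum_list)
  have "weight (Ms \<gamma>) + weight (Ms \<delta>) = weight (Ms \<alpha>) + weight (Ms \<beta>)"
    unfolding sum_weight by (metis eq image_mset_union sum_mset.union)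
  then have keys: "key (Ms \<alpha>) + key (Ms \<beta>) = key (Ms \<gamma>) + key (Ms \<delta>)"
    unfolding key_def rank_def shape by simp
  \<comment> \<open>Stated for either order of \<open>\<alpha>\<close> and \<open>\<beta>\<close>, as both may have the shape of \<open>\<gamma>\<close>.\<close>
  have smaller: "key (Ms \<gamma>) < key (Ms \<epsilon>)"
    if e: "\<epsilon> \<in> indices" "\<zeta> \<in> indices" "mset (se (Ms \<epsilon>)) + mset (se (Ms \<zeta>)) = mset (se (Ms \<alpha>)) + mset (se (Ms \<beta>))"
      "shape (Ms \<gamma>) = shape (Ms \<epsilon>)" "pair \<epsilon> \<zeta> \<noteq> pair \<gamma> \<delta>" for \<epsilon> \<zeta>
  proof -
    note w = aligned_weight[OF Ms_in[OF idx(3)] Ms_in[OF e(1)] eq[folded e(3)] e(4) al[unfolded aligned_iff]]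
    have "Ms \<gamma> \<noteq> Ms \<epsilon>"
    proof
      assume "Ms \<gamma> = Ms \<epsilon>"
      moreover from this have "mset (se (Ms \<delta>)) = mset (se (Ms \<zeta>))" using eq[folded e(3)] by simp
      then have "Ms \<delta> = Ms \<zeta>" by (rule se_inject[OF Ms_in[OF idx(4)] Ms_in[OF e(2)]])
      ultimately show False using e(5) by simp
    qed
    then have "weight (Ms \<gamma>) < weight (Ms \<epsilon>)"
      using w unfolding weight_def by linarith
    then show ?thesis using key_same_shape[OF e(4)] by simp
  qed
  have "key (Ms \<gamma>) < key (Ms \<alpha>)"
    by (rule smaller[OF idx(1,2) refl shape(1) neq])
  moreover have "key (Ms \<gamma>) < key (Ms \<beta>)"
  proof (cases "shape (Ms \<gamma>) = shape (Ms \<beta>)")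
    case True
    show ?thesis
      using smaller[OF idx(2,1) add.commute True] neq by (simp add: add.commute)
  next
    case False
    have "tmon (shape (Ms \<delta>)) \<le> tmon (shape (Ms \<gamma>))"
      using idx \<open>\<gamma> \<le> \<delta>\<close> by (intro Ms_lex)
    moreover have "tmon (shape (Ms \<gamma>)) \<noteq> tmon (shape (Ms \<beta>))"
      using False shape_eq_iff[OF Ms_in[OF idx(3)] Ms_in[OF idx(2)]] by simp
    ultimately have "rank (Ms \<gamma>) < rank (Ms \<beta>)"
      using rank_less[OF Ms_in[OF idx(3)] Ms_in[OF idx(2)]] shape(2) by simp
    then show ?thesis by (rule key_less[OF Ms_in[OF idx(3)] Ms_in[OF idx(2)]])
  qed
  ultimately show ?thesis by (rule sum_squares_less[OF keys])
qed

lemma base_order_related: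
  assumes rel: "rel \<alpha> \<beta> \<gamma> \<delta>" and neq: "pair \<alpha> \<beta> \<noteq> pair \<gamma> \<delta>"
    and Y: "Y (pair \<gamma> \<delta>) = Y (pair \<alpha> \<beta>)" and E: "E (pair \<gamma> \<delta>) = E (pair \<alpha> \<beta>)"
  shows "base_order (pair \<gamma> \<delta>) (pair \<alpha> \<beta>)"
proof -
  have idx: "\<alpha> \<in> indices" "\<beta> \<in> indices" "\<gamma> \<in> indices" "\<delta> \<in> indices"
    and le: "\<gamma> \<le> \<delta>" and al: "aligned (se (Ms \<gamma>)) (se (Ms \<delta>))"
    using rel unfolding related_iff by blast+
  have "var (shape (Ms \<alpha>)) + var (shape (Ms \<beta>)) = var (shape (Ms \<gamma>)) + var (shape (Ms \<delta>))"
    using Y by simp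
  then consider "shape (Ms \<gamma>) = shape (Ms \<alpha>)" "shape (Ms \<delta>) = shape (Ms \<beta>)"
    | "shape (Ms \<gamma>) = shape (Ms \<beta>)" "shape (Ms \<delta>) = shape (Ms \<alpha>)"
    using var_pair_eq[of "shape (Ms \<alpha>)"] by blast
  then have less: "(key (Ms \<alpha>))\<^sup>2 + (key (Ms \<beta>))\<^sup>2 < (key (Ms \<gamma>))\<^sup>2 + (key (Ms \<delta>))\<^sup>2"
  proof cases
    case 1
    show ?thesis by (rule key_squares_less[OF idx le al 1 E[symmetric] neq])
  next
    case 2
    have "pair \<beta> \<alpha> = pair \<alpha> \<beta>" by (rule add.commute)
    then have "E (pair \<beta> \<alpha>) = E (pair \<gamma> \<delta>)" "pair \<beta> \<alpha> \<noteq> pair \<gamma> \<delta>"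
      using E neq by metis+
    then have "(key (Ms \<beta>))\<^sup>2 + (key (Ms \<alpha>))\<^sup>2 < (key (Ms \<gamma>))\<^sup>2 + (key (Ms \<delta>))\<^sup>2"
      by (rule key_squares_less[OF idx(2,1,3,4) le al 2])
    then show ?thesis by (simp add: add.commute)
  qed
  have spread: "spread (Ms \<epsilon>) + (key (Ms \<epsilon>))\<^sup>2 = (\<Sum>M\<in>N. (key M)\<^sup>2)" if "\<epsilon> \<in> indices" for \<epsilon>
    using member_le_sum[OF Ms_in[OF that], of "\<lambda>M. (key M)\<^sup>2"] finite_N by (simp add: spread_def)
  have "spread (Ms \<gamma>) + spread (Ms \<delta>) < spread (Ms \<alpha>) + spread (Ms \<beta>)"
    using less spread[OF idx(1)] spread[OF idx(2)] spread[OF idx(3)] spread[OF idx(4)] by linarith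
  then show ?thesis by (simp add: base_order_def refine_def)
qed

text \<open>
  A normal form is the least monomial of its fiber, so each \<open>\<phi>\<^sub>j\<close> either decreases or stays the same.
\<close>

lemma ord_related:
  assumes rel: "rel \<alpha> \<beta> \<gamma> \<delta>" and neq: "pair \<alpha> \<beta> \<noteq> pair \<gamma> \<delta>"
  shows "ord (pair \<gamma> \<delta>) (pair \<alpha> \<beta>)"
proof -
  let ?a = "pair \<alpha> \<beta>" and ?c = "pair \<gamma> \<delta>"
  have "\<alpha> \<in> indices" "\<beta> \<in> indices" "\<gamma> \<in> indices" "\<delta> \<in> indices"
    and same: "extend (\<lambda>M. M) ?a = extend (\<lambda>M. M) ?c" and red: "reduced_parts ?c"
    using rel unfolding related_iff by blast+
  then have a: "?a \<in> monomials N" and c: "?c \<in> monomials N"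
    by (blast intro: pair_monomials)+
  have Y: "lt0 (Y ?c) (Y ?a)" if "Y ?c \<noteq> Y ?a"
    using same_product_shapes[OF a c same] red Y_monomials[OF a] Y_monomials[OF c] that
    by (intro y.standard_least) (auto simp: reduced_parts_def)
  have Z: "lt i (Z i ?c) (Z i ?a)" if i: "i \<in> set [1..<Suc d]" and neq: "Z i ?c \<noteq> Z i ?a" for i
  proof -
    have i: "i \<in> {1..d}" using i by auto
    interpret toric_groebner "{1..lam i}" "m i" "lt i" "G i"
      using i by (rule toric_groebner_B)
    have "extend (m i) (Z i ?a) = extend (m i) (Z i ?c)"
      using same i unfolding same_product_iff[OF a c] by blast
    then show ?thesis
      using red i Z_monomials[OF a] Z_monomials[OF c] neq
      by (intro standard_least) (auto simp: reduced_parts_def)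
  qed
  have "inner_order [1..<Suc d] ?c ?a" if Y: "Y ?c = Y ?a"
  proof (rule inner_order_less[OF Z])
    assume eq: "\<And>i. i \<in> set [1..<Suc d] \<Longrightarrow> Z i ?c = Z i ?a"
    have "E ?c = E ?a"
    proof (rule E_eqI[OF c a])
      fix i assume "i \<in> {1..d}"
      then have "i \<in> set [1..<Suc d]" by auto
      then show "Z i ?c = Z i ?a" by (rule eq)
    qed
    then show "base_order ?c ?a" by (rule base_order_related[OF rel neq Y])
  qed
  then show ?thesis
    using Y unfolding ord_def refine_def by blast
qed

section \<open>The Groebner basis\<close>

sublocale x: toric_order N "\<lambda>M. M" ord
  by unfold_locales (fact finite_N ord_monomial_order same_product_mdeg)+

abbreviation binomials :: "((nat \<times> nat) monomial, 'k) mpoly set" where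
  "binomials \<equiv> nested_binomials d A lam m lt0 G0 lt G Ms"

lemma quad_binomial: "quad_binomial Ms \<alpha> \<beta> \<gamma> \<delta> = mon (pair \<alpha> \<beta>) - mon (pair \<gamma> \<delta>)"
  by (simp add: quad_binomial_def X_mult)

lemma keys_mon_diff:
  "a \<noteq> b \<Longrightarrow> Poly_Mapping.keys (mon a - mon b :: ('v, 'k) mpoly) = {a, b}"
  by (auto simp: in_keys_iff lookup_minus lookup_mon when_def split: if_splits)

lemma binomials_iff:
  "p \<in> binomials \<longleftrightarrow> (\<exists>\<alpha> \<beta> \<gamma> \<delta>. p = mon (pair \<alpha> \<beta>) - mon (pair \<gamma> \<delta>) \<and> rel \<alpha> \<beta> \<gamma> \<delta> \<and> pair \<alpha> \<beta> \<noteq> pair \<gamma> \<delta>)"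
proof
  assume "p \<in> binomials"
  then have ex: "\<exists>\<alpha> \<beta> \<gamma> \<delta>. p = mon (pair \<alpha> \<beta>) - mon (pair \<gamma> \<delta>) \<and> rel \<alpha> \<beta> \<gamma> \<delta>" and "p \<noteq> 0"
    unfolding nested_binomials_def quad_binomial by (simp_all only: Diff_iff mem_Collect_eq singleton_iff simp_thms)
  from ex obtain \<alpha> \<beta> \<gamma> \<delta> where p: "p = mon (pair \<alpha> \<beta>) - mon (pair \<gamma> \<delta>)" and rel: "rel \<alpha> \<beta> \<gamma> \<delta>"
    by (elim exE conjE)
  have "pair \<alpha> \<beta> \<noteq> pair \<gamma> \<delta>"
    using \<open>p \<noteq> 0\<close> unfolding p by (simp only: right_minus_eq mon_inject not_False_eq_True)
  with p rel show "\<exists>\<alpha> \<beta> \<gamma> \<delta>. p = mon (pair \<alpha> \<beta>) - mon (pair \<gamma> \<delta>) \<and> rel \<alpha> \<beta> \<gamma> \<delta> \<and> pair \<alpha> \<beta> \<noteq> pair \<gamma> \<delta>"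
    by (intro exI conjI)
next
  assume "\<exists>\<alpha> \<beta> \<gamma> \<delta>. p = mon (pair \<alpha> \<beta>) - mon (pair \<gamma> \<delta>) \<and> rel \<alpha> \<beta> \<gamma> \<delta> \<and> pair \<alpha> \<beta> \<noteq> pair \<gamma> \<delta>"
  then obtain \<alpha> \<beta> \<gamma> \<delta> where p: "p = mon (pair \<alpha> \<beta>) - mon (pair \<gamma> \<delta>)" and rel: "rel \<alpha> \<beta> \<gamma> \<delta>"
    and neq: "pair \<alpha> \<beta> \<noteq> pair \<gamma> \<delta>"
    by (elim exE conjE)
  have "p \<noteq> 0"
    using neq unfolding p by (simp only: right_minus_eq mon_inject not_False_eq_True)
  then show "p \<in> binomials"
    unfolding nested_binomials_def quad_binomial Diff_iff mem_Collect_eq singleton_iff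
    using p rel by (intro exI conjI)
qed

lemma init_binomial:
  assumes "rel \<alpha> \<beta> \<gamma> \<delta>" "pair \<alpha> \<beta> \<noteq> pair \<gamma> \<delta>"
  shows "init ord (mon (pair \<alpha> \<beta>) - mon (pair \<gamma> \<delta>) :: ((nat \<times> nat) monomial, 'k) mpoly) = pair \<alpha> \<beta>"
proof (rule init_eqI[OF ord_monomial_order])
  have "\<alpha> \<in> indices" "\<beta> \<in> indices" "\<gamma> \<in> indices" "\<delta> \<in> indices"
    using assms(1) unfolding related_iff by blast+
  then have "pair \<alpha> \<beta> \<in> monomials N" "pair \<gamma> \<delta> \<in> monomials N"
    by (blast intro: pair_monomials)+
  then show "(mon (pair \<alpha> \<beta>) - mon (pair \<gamma> \<delta>) :: ((nat \<times> nat) monomial, 'k) mpoly) \<in> polys N"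
    by (intro polys_diff) (simp_all only: polys_mon)
next
  fix b assume "b \<in> Poly_Mapping.keys (mon (pair \<alpha> \<beta>) - mon (pair \<gamma> \<delta>) :: ((nat \<times> nat) monomial, 'k) mpoly)" "b \<noteq> pair \<alpha> \<beta>"
  then have "b = pair \<gamma> \<delta>" unfolding keys_mon_diff[OF assms(2)] by blast
  with ord_related[OF assms] show "ord b (pair \<alpha> \<beta>)" by (simp only:)
qed (simp only: keys_mon_diff[OF assms(2)] insert_iff simp_thms)

lemma binomials_toric: "binomials \<subseteq> toric_ideal N (\<lambda>M. M) - {0}"
proof
  fix p assume "p \<in> binomials"
  then obtain \<alpha> \<beta> \<gamma> \<delta> where p: "p = mon (pair \<alpha> \<beta>) - mon (pair \<gamma> \<delta>)"
    and rel: "rel \<alpha> \<beta> \<gamma> \<delta>" and neq: "pair \<alpha> \<beta> \<noteq> pair \<gamma> \<delta>"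
    unfolding binomials_iff by (elim exE conjE)
  have "\<alpha> \<in> indices" "\<beta> \<in> indices" "\<gamma> \<in> indices" "\<delta> \<in> indices"
    and same: "extend (\<lambda>M. M) (pair \<alpha> \<beta>) = extend (\<lambda>M. M) (pair \<gamma> \<delta>)"
    using rel unfolding related_iff by blast+
  then have "pair \<alpha> \<beta> \<in> monomials N" "pair \<gamma> \<delta> \<in> monomials N"
    by (blast intro: pair_monomials)+
  then have "p \<in> toric_ideal N (\<lambda>M. M)"
    using same unfolding p by (simp only: binomial_in_toric_ideal)
  moreover have "p \<noteq> 0"
    using neq unfolding p by (simp only: right_minus_eq mon_inject not_False_eq_True)
  ultimately show "p \<in> toric_ideal N (\<lambda>M. M) - {0}" by blast
qed

lemma finite_binomials: "finite binomials"
proof -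
  have "binomials \<subseteq> (\<lambda>(\<alpha>, \<beta>, \<gamma>, \<delta>). quad_binomial Ms \<alpha> \<beta> \<gamma> \<delta>) ` (indices \<times> indices \<times> indices \<times> indices)"
    unfolding nested_binomials_def related_def by force
  then show ?thesis by (rule finite_subset) simp
qed

lemma quadratic_binomials:
  assumes "p \<in> binomials"
  shows "quadratic p"
  using assms by (auto simp: binomials_iff quadratic_def keys_mon_diff)

text \<open>
  If a pair dividing \<open>u\<close> differed from its related pair, their difference would be a binomial whose initial monomial
  divides \<open>u\<close>.
\<close>

lemma standard_pair:
  assumes "standard ord binomials u" "\<alpha> \<in> indices" "\<beta> \<in> indices" "divides (pair \<alpha> \<beta>) u"
  obtains \<gamma> \<delta> where "rel \<alpha> \<beta> \<gamma> \<delta>" "pair \<alpha> \<beta> = pair \<gamma> \<delta>"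
proof -
  obtain \<gamma> \<delta> where rel: "rel \<alpha> \<beta> \<gamma> \<delta>" using ex_related[OF assms(2,3)] by blast
  have "pair \<alpha> \<beta> = pair \<gamma> \<delta>"
  proof (rule ccontr)
    assume neq: "pair \<alpha> \<beta> \<noteq> pair \<gamma> \<delta>"
    then have "mon (pair \<alpha> \<beta>) - mon (pair \<gamma> \<delta>) \<in> binomials"
      using rel unfolding binomials_iff by blast
    then show False
      using assms(1,4) init_binomial[OF rel neq] unfolding standard_def by metis
  qed
  with rel show thesis by (rule that)
qed

lemma standard_var: "standard lt0 G0 (var I)"
  unfolding standard_def
proof (intro ballI notI)
  fix g assume g: "g \<in> G0" "divides (init lt0 g) (var I)"
  then obtain c where c: "var I = init lt0 g + c" by (auto simp: divides_def)
  have "mdeg (var I) = mdeg (init lt0 g) + mdeg c" unfolding c by simp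
  then show False using y.G_init(2)[OF g(1)] by simp
qed

text \<open>
  For every two variables dividing a standard monomial, the related pair from \<open>ex_related\<close> must be the pair
  itself, as otherwise its binomial would reduce the monomial. So all products of two variables
  have standard images and are aligned, and this extends to the whole monomial.
\<close>

lemma standard_binomials:
  assumes u: "u \<in> monomials N" and std: "standard ord binomials u"
  shows "reduced_parts u" "pairwise_aligned u"
proof -
  have red: "reduced_parts (var M + var M')" if uM: "u = var M + var M' + u'" for M M' u'
  proof -
    have "M \<in> N" "M' \<in> N" using u uM by simp_all
    then obtain \<alpha> \<beta> where \<alpha>: "\<alpha> \<in> indices" "M = Ms \<alpha>" and \<beta>: "\<beta> \<in> indices" "M' = Ms \<beta>"
      using Ms_surj by metis
    have "divides (pair \<alpha> \<beta>) u" using uM \<alpha>(2) \<beta>(2) by (auto simp: divides_def)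
    then obtain \<gamma> \<delta> where "rel \<alpha> \<beta> \<gamma> \<delta>" "pair \<alpha> \<beta> = pair \<gamma> \<delta>"
      by (rule standard_pair[OF std \<alpha>(1) \<beta>(1)])
    then show ?thesis unfolding related_iff \<alpha>(2) \<beta>(2) by simp
  qed
  have "standard lt0 G0 (Y u)"
    unfolding Y_def
  proof (rule y.standard_extendI[OF u])
    show "standard lt0 G0 (var (shape M))" for M by (rule standard_var)
    show "standard lt0 G0 (var (shape M) + var (shape M'))" if "u = var M + var M' + u'" for M M' u'
      using red[OF that] by (simp add: reduced_parts_def)
  qed
  moreover have "standard (lt i) (G i) (Z i u)" if i: "i \<in> {1..d}" for i
  proof -
    interpret toric_groebner "{1..lam i}" "m i" "lt i" "G i"
      using i by (rule toric_groebner_B)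
    show ?thesis
      unfolding Z_def
    proof (rule standard_extendI[OF u])
      show "standard (lt i) (G i) (zpart i (se M))" if "M \<in> N" for M
        using that i by (rule zpart_se_standard)
      show "standard (lt i) (G i) (zpart i (se M) + zpart i (se M'))" if "u = var M + var M' + u'" for M M' u'
        using red[OF that] i by (simp add: reduced_parts_def)
    qed
  qed
  ultimately show "reduced_parts u" by (simp add: reduced_parts_def)
  show "pairwise_aligned u"
    unfolding pairwise_aligned_def
  proof (intro ballI impI)
    fix \<alpha> \<beta> assume idx: "\<alpha> \<in> indices" "\<beta> \<in> indices" "\<alpha> \<le> \<beta>" and "divides (pair \<alpha> \<beta>) u"
    then obtain \<gamma> \<delta> where "rel \<alpha> \<beta> \<gamma> \<delta>" "pair \<alpha> \<beta> = pair \<gamma> \<delta>"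
      using standard_pair[OF std] by blast
    then have "pairwise_aligned (pair \<alpha> \<beta>)" using related_pairwise_aligned by simp
    moreover have "divides (pair \<alpha> \<beta>) (pair \<alpha> \<beta>)" unfolding divides_def by (rule exI[of _ 0]) simp
    ultimately show "aligned (se (Ms \<alpha>)) (se (Ms \<beta>))"
      using idx unfolding pairwise_aligned_def by blast
  qed
qed

lemma binomials_groebner: "groebner_basis N ord (toric_ideal N (\<lambda>M. M)) binomials"
proof (rule x.groebner_basis_criterion[OF finite_binomials binomials_toric])
  fix u v assume uv: "x.same_fiber u v" and "standard ord binomials u" "standard ord binomials v"
  then show "u = v"
    using standard_binomials[of u] standard_binomials[of v] by (intro standard_monomial_unique) auto
qed

text \<open>
  Trailing monomials are standard, so a fiber contains only one of them.
\<close>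

lemma related_unique:
  assumes "rel \<alpha> \<beta> \<gamma> \<delta>" "rel \<alpha>' \<beta>' \<gamma>' \<delta>'" 
    and "extend (\<lambda>M. M) (pair \<alpha> \<beta>) = extend (\<lambda>M. M) (pair \<alpha>' \<beta>')"
  shows "pair \<gamma> \<delta> = pair \<gamma>' \<delta>'"
proof (rule standard_monomial_unique)
  have idx: "\<gamma> \<in> indices" "\<delta> \<in> indices" "\<gamma>' \<in> indices" "\<delta>' \<in> indices"
    using assms(1,2) unfolding related_iff by blast+
  show "pair \<gamma> \<delta> \<in> monomials N" "pair \<gamma>' \<delta>' \<in> monomials N"
    using idx by (blast intro: pair_monomials)+
  show "reduced_parts (pair \<gamma> \<delta>)" "reduced_parts (pair \<gamma>' \<delta>')"
    using assms(1,2) unfolding related_iff by blast+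
  show "extend (\<lambda>M. M) (pair \<gamma> \<delta>) = extend (\<lambda>M. M) (pair \<gamma>' \<delta>')"
    using assms unfolding related_iff by (metis (no_types))
qed (use assms related_pairwise_aligned in blast)+

text \<open>
  All initial and trailing monomials have degree two, so divisibility between them is equality. A
  common fiber forces the same trailing monomial, which is therefore never initial itself.
\<close>

lemma binomials_reduced: "reduced_groebner_basis N ord (toric_ideal N (\<lambda>M. M)) binomials"
  unfolding reduced_groebner_basis_def
proof (intro conjI ballI impI binomials_groebner notI)
  fix g assume "g \<in> binomials"
  then obtain \<alpha> \<beta> \<gamma> \<delta> where g: "g = mon (pair \<alpha> \<beta>) - mon (pair \<gamma> \<delta>)"
    and rel: "rel \<alpha> \<beta> \<gamma> \<delta>" and neq: "pair \<alpha> \<beta> \<noteq> pair \<gamma> \<delta>"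
    unfolding binomials_iff by (elim exE conjE)
  show "Poly_Mapping.lookup g (init ord g) = 1"
    unfolding g init_binomial[OF rel neq] using neq by (simp add: lookup_minus lookup_mon)
  fix h a assume "h \<in> binomials" "g \<noteq> h" "a \<in> Poly_Mapping.keys g" and div: "divides (init ord h) a"
  then obtain \<alpha>' \<beta>' \<gamma>' \<delta>' where h: "h = mon (pair \<alpha>' \<beta>') - mon (pair \<gamma>' \<delta>')"
    and rel': "rel \<alpha>' \<beta>' \<gamma>' \<delta>'" and neq': "pair \<alpha>' \<beta>' \<noteq> pair \<gamma>' \<delta>'"
    unfolding binomials_iff by (elim exE conjE)
  have same: "extend (\<lambda>M. M) (pair \<alpha> \<beta>) = extend (\<lambda>M. M) (pair \<gamma> \<delta>)"
    using rel unfolding related_iff by blast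
  have a: "a = pair \<alpha> \<beta> \<or> a = pair \<gamma> \<delta>"
    using \<open>a \<in> Poly_Mapping.keys g\<close> unfolding g keys_mon_diff[OF neq] by blast
  obtain c where c: "a = pair \<alpha>' \<beta>' + c"
    using div unfolding h init_binomial[OF rel' neq'] divides_def by blast
  have "mdeg a = 2" using a by auto
  then have "c = 0" unfolding c by simp
  with c have a': "a = pair \<alpha>' \<beta>'" by simp
  have "extend (\<lambda>M. M) (pair \<alpha> \<beta>) = extend (\<lambda>M. M) (pair \<alpha>' \<beta>')"
    using a a' same by metis
  then have eq: "pair \<gamma> \<delta> = pair \<gamma>' \<delta>'"
    by (rule related_unique[OF rel rel'])
  show False
    using a
  proof
    assume "a = pair \<alpha> \<beta>"
    then have "g = h" unfolding g h using a' eq by (simp only:)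
    with \<open>g \<noteq> h\<close> show False ..
  next
    assume "a = pair \<gamma> \<delta>"
    with a' eq neq' show False by (simp only:)
  qed
qed

end

theorem theorem3p6:
  fixes d :: nat
    and A :: "nat monomial set"
    and mu lam :: "nat \<Rightarrow> nat"
    and m :: "nat \<Rightarrow> nat \<Rightarrow> (nat \<times> nat) monomial"
    and lt0 :: "nat list monomial \<Rightarrow> nat list monomial \<Rightarrow> bool"
    and lt :: "nat \<Rightarrow> nat monomial \<Rightarrow> nat monomial \<Rightarrow> bool"
    and G0 :: "(nat list, 'k::field) mpoly set"
    and G :: "nat \<Rightarrow> (nat, 'k) mpoly set"
  assumes "configuration {1..d} A"
    and "\<And>i. i \<in> {1..d} \<Longrightarrow> inj_on (m i) {1..lam i}"
    and "\<And>i. i \<in> {1..d} \<Longrightarrow> configuration ({i} \<times> {1..mu i}) (m i ` {1..lam i})"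
    and "monomial_order (yvars d A) lt0"
    and "groebner_basis (yvars d A) lt0 (toric_ideal (yvars d A) tmon) G0"
    and "\<forall>g\<in>G0. quadratic g"
    and "\<And>i. i \<in> {1..d} \<Longrightarrow> monomial_order {1..lam i} (lt i)"
    and "\<And>i. i \<in> {1..d} \<Longrightarrow> groebner_basis {1..lam i} (lt i) (toric_ideal {1..lam i} (m i)) (G i)"
    and "\<And>i. i \<in> {1..d} \<Longrightarrow> \<forall>g\<in>G i. quadratic g"
  defines "N \<equiv> nested d A lam m"
  defines "I \<equiv> toric_ideal N (\<lambda>M. M) :: ((nat \<times> nat) monomial, 'k) mpoly set"
  shows "(\<exists>ord H. monomial_order N ord \<and> groebner_basis N ord I H \<and> (\<forall>h\<in>H. quadratic h)) \<and>
         (\<exists>Ms. enumeration d A lam m lt G Ms \<and> ties_aligned d A lam m lt G Ms) \<and>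
         (\<forall>Ms. enumeration d A lam m lt G Ms \<and> ties_aligned d A lam m lt G Ms \<longrightarrow>
           (\<exists>ord. monomial_order N ord \<and>
              reduced_groebner_basis N ord I (nested_binomials d A lam m lt0 G0 lt G Ms) \<and>
              (\<forall>g\<in>nested_binomials d A lam m lt0 G0 lt G Ms. quadratic g) \<and>
              (\<forall>\<alpha> \<beta> \<gamma> \<delta>. related d A lam m lt0 G0 lt G Ms \<alpha> \<beta> \<gamma> \<delta> \<and>
                 (quad_binomial Ms \<alpha> \<beta> \<gamma> \<delta> :: ((nat \<times> nat) monomial, 'k) mpoly) \<noteq> 0 \<longrightarrow>
                 init ord (quad_binomial Ms \<alpha> \<beta> \<gamma> \<delta> :: ((nat \<times> nat) monomial, 'k) mpoly) =
                   Poly_Mapping.single (Ms \<alpha>) 1 + Poly_Mapping.single (Ms \<beta>) 1)))"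
proof -
  interpret nested_configuration d A mu lam m lt0 lt G0 G
    by unfold_locales (use assms(1,3-9) in blast)+
  have main: "\<exists>ord. monomial_order N ord \<and>
      reduced_groebner_basis N ord I (nested_binomials d A lam m lt0 G0 lt G Ms) \<and>
      (\<forall>g\<in>nested_binomials d A lam m lt0 G0 lt G Ms. quadratic g) \<and>
      (\<forall>\<alpha> \<beta> \<gamma> \<delta>. related d A lam m lt0 G0 lt G Ms \<alpha> \<beta> \<gamma> \<delta> \<and>
         (quad_binomial Ms \<alpha> \<beta> \<gamma> \<delta> :: ((nat \<times> nat) monomial, 'k) mpoly) \<noteq> 0 \<longrightarrow>
         init ord (quad_binomial Ms \<alpha> \<beta> \<gamma> \<delta> :: ((nat \<times> nat) monomial, 'k) mpoly) =
           Poly_Mapping.single (Ms \<alpha>) 1 + Poly_Mapping.single (Ms \<beta>) 1)"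
    if enum: "enumeration d A lam m lt G Ms" and ties: "ties_aligned d A lam m lt G Ms" for Ms
  proof -
    interpret enumerated_configuration d A mu lam m lt0 lt G0 G Ms
      by unfold_locales (fact enum ties)+
    have "init ord (quad_binomial Ms \<alpha> \<beta> \<gamma> \<delta> :: ((nat \<times> nat) monomial, 'k) mpoly) = pair \<alpha> \<beta>"
      if "related d A lam m lt0 G0 lt G Ms \<alpha> \<beta> \<gamma> \<delta>"
        and "(quad_binomial Ms \<alpha> \<beta> \<gamma> \<delta> :: ((nat \<times> nat) monomial, 'k) mpoly) \<noteq> 0" for \<alpha> \<beta> \<gamma> \<delta>
    proof -
      have "pair \<alpha> \<beta> \<noteq> pair \<gamma> \<delta>"
        using that(2) unfolding quad_binomial by (metis right_minus_eq)
      with that(1) show ?thesis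
        unfolding quad_binomial by (rule init_binomial)
    qed
    then show ?thesis
      unfolding N_def I_def
      using ord_monomial_order binomials_reduced quadratic_binomials
      by (intro exI[of _ ord] conjI allI impI ballI) (elim conjE, assumption | blast)+
  qed
  obtain Ms where Ms: "enumeration d A lam m lt G Ms" "ties_aligned d A lam m lt G Ms"
    using ex_enumeration by (elim exE conjE)
  from main[OF this] obtain ord where "monomial_order N ord"
    "groebner_basis N ord I (nested_binomials d A lam m lt0 G0 lt G Ms)"
    "\<forall>g\<in>nested_binomials d A lam m lt0 G0 lt G Ms. quadratic g"
    unfolding reduced_groebner_basis_def by (elim exE conjE)
  then have "\<exists>ord H. monomial_order N ord \<and> groebner_basis N ord I H \<and> (\<forall>h\<in>H. quadratic h)"
    by (intro exI conjI)
  with Ms main show ?thesis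
    by (intro conjI allI impI) (blast | elim conjE)+
qed

end
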